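(* Let $w$ be a positive integer, $p_1,\ldots,p_w\in\mathbb{R}[y]$, and $\mathbb{N}=S_1\cup\cdots\cup S_w$ a partition with each $1_{S_v}$ deterministic; set $g(n)=\sum_{v=1}^w1_{S_v}(n)p_v(n)$. Suppose $\mathcal{D}$ is a family of real-valued arithmetic functions such that \[\lim_{n\to\infty}\sup_{f\in\mathcal{D}}\|\triangle^k f(n)-g(n)\|=0\] for some integer $k\ge1$. Assume Sarnak's Möbius disjointness conjecture, i.e. that $\lim_{N\to\infty}\frac1N\sum_{n=1}^N\mu(n)\xi(n)=0$ for every deterministic sequence $\xi$. Then for any deterministic sequence $\xi(n)$, \[\lim_{h\to\infty}\limsup_{X\to\infty}\frac{1}{Xh}\int_X^{2X}\sup_{f\in\mathcal{D}}\Big|\sum_{x\le n<x+h}\mu(n)\xi(n)e(f(n))\Big|\,dx=0.\]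
   Context: $\mathbb{N}=\{0,1,2,\ldots\}$; $\mu$ is the Möbius function. An arithmetic function $\xi:\mathbb{N}\to\mathbb{C}$ is deterministic if there exist a compact Hausdorff space $\mathcal{X}$, a continuous $T:\mathcal{X}\to\mathcal{X}$ of zero topological entropy, $x_0\in\mathcal{X}$ and continuous $F:\mathcal{X}\to\mathbb{C}$ with $\xi(n)=F(T^nx_0)$. $e(x)=\exp(2\pi ix)$; $\|x\|$ is the distance to the nearest integer; $(\triangle f)(n)=f(n+1)-f(n)$, $\triangle^k$ its $k$-fold iterate. *)

theory Defs
  imports
    "HOL-Analysis.Analysis"
    "HOL-Computational_Algebra.Squarefree"
    "HOL-Computational_Algebra.Polynomial"
begin

text \<open>Entropy is defined by open covers (Adler, Konheim and McAndrew), so that no metrizability is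
  needed. A self-map of a topological space \<open>X\<close> is a HOL function \<open>T\<close> with
  \<open>continuous_map X X T\<close>; its values outside \<open>topspace X\<close> play no role.\<close>

definition open_cover :: "'a topology \<Rightarrow> 'a set set \<Rightarrow> bool" where
  "open_cover X U \<longleftrightarrow> (\<forall>A\<in>U. openin X A) \<and> \<Union>U = topspace X"

text \<open>The common refinement of the preimages of \<open>U\<close> under \<open>T ^^ i\<close>, \<open>i < n\<close>.\<close>

definition cover_refinement ::
    "'a topology \<Rightarrow> ('a \<Rightarrow> 'a) \<Rightarrow> 'a set set \<Rightarrow> nat \<Rightarrow> 'a set set" where
  "cover_refinement X T U n =
     {{x \<in> topspace X. \<forall>i<n. (T ^^ i) x \<in> A i} | A. \<forall>i<n. A i \<in> U}"

definition min_subcover_card :: "'a topology \<Rightarrow> 'a set set \<Rightarrow> nat" where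
  "min_subcover_card X U = Inf (card ` {V. V \<subseteq> U \<and> finite V \<and> \<Union>V = topspace X})"

text \<open>The sequence under the \<open>limsup\<close> converges, by subadditivity of
  \<open>n \<mapsto> ln (min_subcover_card X (cover_refinement X T U n))\<close>; hence \<open>limsup\<close> is the limit
  of the usual definition.\<close>

definition cover_entropy :: "'a topology \<Rightarrow> ('a \<Rightarrow> 'a) \<Rightarrow> 'a set set \<Rightarrow> ereal" where
  "cover_entropy X T U =
     limsup (\<lambda>n. ereal (ln (real (min_subcover_card X (cover_refinement X T U n))) / real n))"

definition topological_entropy :: "'a topology \<Rightarrow> ('a \<Rightarrow> 'a) \<Rightarrow> ereal" where
  "topological_entropy X T = (SUP U\<in>{U. open_cover X U}. cover_entropy X T U)"

definition deterministic_on :: "'a topology \<Rightarrow> (nat \<Rightarrow> complex) \<Rightarrow> bool" where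
  "deterministic_on X \<xi> \<longleftrightarrow>
     compact_space X \<and> Hausdorff_space X \<and>
     (\<exists>T x0 F. continuous_map X X T \<and> topological_entropy X T = 0 \<and> x0 \<in> topspace X \<and>
        continuous_map X euclidean F \<and> (\<forall>n. \<xi> n = F ((T ^^ n) x0)))"

text \<open>HOL cannot quantify existentially over the type of points of the space. The spaces
  carried by subsets of \<open>nat \<Rightarrow> complex\<close> suffice: the lemma \<open>deterministicI\<close> below shows that a
  function realized on a compact Hausdorff space with points of any type is deterministic in
  this sense.\<close>

definition deterministic :: "(nat \<Rightarrow> complex) \<Rightarrow> bool" where
  "deterministic \<xi> \<longleftrightarrow> (\<exists>X :: (nat \<Rightarrow> complex) topology. deterministic_on X \<xi>)"

lemma funpow_in_topspace:
  assumes "continuous_map X X T" "x \<in> topspace X"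
  shows "(T ^^ n) x \<in> topspace X"
  using assms by (induction n) (auto dest: continuous_map_funspace)

lemma continuous_map_funpow:
  assumes "continuous_map X X T"
  shows "continuous_map X X (T ^^ n)"
proof (induction n)
  case 0
  then show ?case by simp
next
  case (Suc n)
  then show ?case using continuous_map_compose[OF Suc assms] by (simp add: o_def)
qed

lemma openin_cover_refinement:
  assumes T: "continuous_map X X T" and U: "open_cover X U"
    and B: "B \<in> cover_refinement X T U n"
  shows "openin X B"
proof -
  obtain A where B_eq: "B = {x \<in> topspace X. \<forall>i<n. (T ^^ i) x \<in> A i}" and A: "\<forall>i<n. A i \<in> U"
    using B unfolding cover_refinement_def by blast
  have "openin X {x \<in> topspace X. (T ^^ i) x \<in> A i}" if "i < n" for i
    using U A that continuous_map_funpow[OF T, of i]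
    unfolding open_cover_def by (intro openin_continuous_map_preimage) auto
  then have "openin X (topspace X \<inter> (\<Inter>i\<in>{..<n}. {x \<in> topspace X. (T ^^ i) x \<in> A i}))"
    by (cases "n = 0") (auto intro!: openin_Int openin_INT2)
  also have "topspace X \<inter> (\<Inter>i\<in>{..<n}. {x \<in> topspace X. (T ^^ i) x \<in> A i}) = B"
    unfolding B_eq by auto
  finally show ?thesis .
qed

lemma open_cover_refinement:
  assumes T: "continuous_map X X T" and U: "open_cover X U"
  shows "open_cover X (cover_refinement X T U n)"
  unfolding open_cover_def
proof (intro conjI ballI equalityI subsetI)
  fix B assume "B \<in> cover_refinement X T U n"
  then show "openin X B" by (rule openin_cover_refinement[OF T U])
next
  fix x assume "x \<in> \<Union>(cover_refinement X T U n)"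
  then show "x \<in> topspace X" unfolding cover_refinement_def by auto
next
  fix x assume x: "x \<in> topspace X"
  have "\<exists>A\<in>U. (T ^^ i) x \<in> A" for i
    using funpow_in_topspace[OF T x, of i] U unfolding open_cover_def by blast
  then obtain A where "\<And>i. A i \<in> U" "\<And>i. (T ^^ i) x \<in> A i" by metis
  then show "x \<in> \<Union>(cover_refinement X T U n)"
    using x unfolding cover_refinement_def by blast
qed

lemma min_subcover_card_attained:
  assumes "compact_space X" "open_cover X U"
  obtains V where "V \<subseteq> U" "finite V" "\<Union>V = topspace X" "card V = min_subcover_card X U"
proof -
  obtain V0 where "finite V0" "V0 \<subseteq> U" "topspace X \<subseteq> \<Union>V0"
    using assms unfolding compact_space_alt open_cover_def by (metis order_refl)
  moreover from this have "\<Union>V0 = topspace X"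
    using assms(2) unfolding open_cover_def by blast
  ultimately have "card ` {V. V \<subseteq> U \<and> finite V \<and> \<Union>V = topspace X} \<noteq> {}" by blast
  then have "min_subcover_card X U \<in> card ` {V. V \<subseteq> U \<and> finite V \<and> \<Union>V = topspace X}"
    unfolding min_subcover_card_def by (rule Inf_nat_def1)
  then obtain V where "V \<subseteq> U" "finite V" "\<Union>V = topspace X" "min_subcover_card X U = card V"
    by blast
  then show thesis by (intro that) simp_all
qed

lemma min_subcover_card_le:
  assumes "V \<subseteq> U" "finite V" "\<Union>V = topspace X"
  shows "min_subcover_card X U \<le> card V"
  unfolding min_subcover_card_def using assms by (intro cInf_lower imageI CollectI conjI) simp_all

lemma min_subcover_card_pos:
  assumes "compact_space X" "open_cover X U" "topspace X \<noteq> {}"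
  shows "min_subcover_card X U > 0"
proof -
  obtain V where V: "V \<subseteq> U" "finite V" "\<Union>V = topspace X" "card V = min_subcover_card X U"
    using min_subcover_card_attained[OF assms(1,2)] .
  have "V \<noteq> {}" using assms(3) unfolding V(3)[symmetric] by blast
  then show ?thesis using V(2) by (simp add: card_gt_0_iff flip: V(4))
qed

lemma cover_entropy_nonneg: "cover_entropy X T U \<ge> 0"
  unfolding cover_entropy_def
proof (rule le_Limsup)
  have "ln (real m) \<ge> 0" for m :: nat by (cases "m = 0") auto
  then show "\<forall>\<^sub>F n in sequentially. 0 \<le>
      ereal (ln (real (min_subcover_card X (cover_refinement X T U n))) / real n)"
    by (intro always_eventually allI) (simp add: zero_ereal_def)
qed (rule sequentially_bot)

lemma topological_entropy_nonneg: "topological_entropy X T \<ge> 0"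
proof -
  have "open_cover X {topspace X}" unfolding open_cover_def by auto
  then show ?thesis
    unfolding topological_entropy_def
    by (intro SUP_upper2[of "{topspace X}"]) (auto intro: cover_entropy_nonneg)
qed

text \<open>Entropy does not increase under factor maps.\<close>

lemma topological_entropy_factor:
  assumes X: "compact_space X" "topspace X \<noteq> {}" and Y: "compact_space Y"
    and T: "continuous_map X X T" and S: "continuous_map Y Y S"
    and \<Phi>: "continuous_map X Y \<Phi>" and surj: "\<Phi> ` topspace X = topspace Y"
    and comm: "\<And>x. x \<in> topspace X \<Longrightarrow> \<Phi> (T x) = S (\<Phi> x)"
  shows "topological_entropy Y S \<le> topological_entropy X T"
  unfolding topological_entropy_def
proof (rule SUP_mono)
  fix U assume "U \<in> {U. open_cover Y U}"
  then have U: "open_cover Y U" by simp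
  define pull where "pull = (\<lambda>B. {x \<in> topspace X. \<Phi> x \<in> B})"
  have comm': "\<Phi> ((T ^^ i) x) = (S ^^ i) (\<Phi> x)" if "x \<in> topspace X" for i x
    using that comm funpow_in_topspace[OF T that] by (induction i) auto
  have V: "open_cover X (pull ` U)"
    unfolding open_cover_def
  proof (intro conjI ballI equalityI subsetI)
    fix A assume "A \<in> pull ` U"
    then show "openin X A"
      using U \<Phi> unfolding open_cover_def pull_def by (auto intro: openin_continuous_map_preimage)
  next
    fix x assume "x \<in> \<Union>(pull ` U)"
    then show "x \<in> topspace X" unfolding pull_def by auto
  next
    fix x assume x: "x \<in> topspace X"
    then have "\<Phi> x \<in> topspace Y" using surj by (metis imageI)
    then have "\<Phi> x \<in> \<Union>U" using U unfolding open_cover_def by simp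
    then show "x \<in> \<Union>(pull ` U)" using x unfolding pull_def by blast
  qed
  have refine: "\<exists>C\<in>cover_refinement Y S U n. B = pull C"
    if B: "B \<in> cover_refinement X T (pull ` U) n" for B n
  proof -
    obtain A where B_eq: "B = {x \<in> topspace X. \<forall>i<n. (T ^^ i) x \<in> A i}"
      and A: "\<forall>i<n. A i \<in> pull ` U"
      using B unfolding cover_refinement_def by blast
    from A obtain A' where A': "\<forall>i<n. A' i \<in> U \<and> A i = pull (A' i)"
      by (auto simp: image_iff) metis
    have "{y \<in> topspace Y. \<forall>i<n. (S ^^ i) y \<in> A' i} \<in> cover_refinement Y S U n"
      using A' unfolding cover_refinement_def by blast
    moreover have "B = pull {y \<in> topspace Y. \<forall>i<n. (S ^^ i) y \<in> A' i}"
    proof (intro equalityI subsetI)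
      fix x assume x: "x \<in> B"
      then have xX: "x \<in> topspace X" unfolding B_eq by simp
      then have "\<Phi> x \<in> topspace Y" using surj by (metis imageI)
      moreover have "(S ^^ i) (\<Phi> x) \<in> A' i" if "i < n" for i
      proof -
        have "(T ^^ i) x \<in> pull (A' i)" using x that A' unfolding B_eq by auto
        then show ?thesis using comm'[OF xX, of i] unfolding pull_def by simp
      qed
      ultimately show "x \<in> pull {y \<in> topspace Y. \<forall>i<n. (S ^^ i) y \<in> A' i}"
        using xX unfolding pull_def by simp
    next
      fix x assume x: "x \<in> pull {y \<in> topspace Y. \<forall>i<n. (S ^^ i) y \<in> A' i}"
      then have xX: "x \<in> topspace X" unfolding pull_def by simp
      have "(T ^^ i) x \<in> A i" if "i < n" for i
      proof -
        have "\<Phi> ((T ^^ i) x) \<in> A' i"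
          using x that comm'[OF xX, of i] unfolding pull_def by simp
        then show ?thesis
          using A' that funpow_in_topspace[OF T xX, of i] unfolding pull_def by simp
      qed
      then show "x \<in> B" unfolding B_eq using xX by simp
    qed
    ultimately show ?thesis by blast
  qed
  have le: "min_subcover_card Y (cover_refinement Y S U n)
              \<le> min_subcover_card X (cover_refinement X T (pull ` U) n)" for n
  proof -
    obtain W where W: "W \<subseteq> cover_refinement X T (pull ` U) n" "finite W" "\<Union>W = topspace X"
      "card W = min_subcover_card X (cover_refinement X T (pull ` U) n)"
      using min_subcover_card_attained[OF X(1) open_cover_refinement[OF T V]] .
    have "\<forall>B\<in>W. \<exists>C. C \<in> cover_refinement Y S U n \<and> B = pull C"
      using W(1) refine by blast
    then have "\<exists>c. \<forall>B\<in>W. c B \<in> cover_refinement Y S U n \<and> B = pull (c B)"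
      by (rule bchoice)
    then obtain c
      where c: "\<And>B. B \<in> W \<Longrightarrow> c B \<in> cover_refinement Y S U n \<and> B = pull (c B)"
      by blast
    have "\<Union>(c ` W) = topspace Y"
    proof (intro equalityI subsetI)
      fix y assume "y \<in> \<Union>(c ` W)"
      then show "y \<in> topspace Y" using c unfolding cover_refinement_def by blast
    next
      fix y assume "y \<in> topspace Y"
      then obtain x where x: "x \<in> topspace X" "y = \<Phi> x" unfolding surj[symmetric] by blast
      then obtain B where "B \<in> W" "x \<in> B" using W(3) by blast
      then have "x \<in> pull (c B)" using c by blast
      then show "y \<in> \<Union>(c ` W)" using \<open>B \<in> W\<close> x(2) unfolding pull_def by blast
    qed
    then have "min_subcover_card Y (cover_refinement Y S U n) \<le> card (c ` W)"
      using c W(2) by (intro min_subcover_card_le) auto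
    also have "\<dots> \<le> card W" by (rule card_image_le[OF W(2)])
    finally show ?thesis using W(4) by simp
  qed
  have pos: "min_subcover_card Y (cover_refinement Y S U n) > 0" for n
  proof (intro min_subcover_card_pos Y open_cover_refinement[OF S U])
    show "topspace Y \<noteq> {}" using X(2) unfolding surj[symmetric] by blast
  qed
  have "cover_entropy Y S U \<le> cover_entropy X T (pull ` U)"
    unfolding cover_entropy_def
    using le pos by (intro Limsup_mono always_eventually)
      (auto intro!: divide_right_mono ln_mono)
  then show "\<exists>V\<in>{U. open_cover X U}. cover_entropy Y S U \<le> cover_entropy X T V"
    using V by blast
qed

lemma deterministicI:
  fixes X :: "'a topology"
  assumes "deterministic_on X \<xi>"
  shows "deterministic \<xi>"
proof -
  from assms obtain T x0 F where X: "compact_space X" and T: "continuous_map X X T"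
    and ent: "topological_entropy X T = 0" and x0: "x0 \<in> topspace X"
    and F: "continuous_map X euclidean F" and \<xi>: "\<And>n. \<xi> n = F ((T ^^ n) x0)"
    unfolding deterministic_on_def by blast
  define \<Phi> where "\<Phi> = (\<lambda>x n. F ((T ^^ n) x))"
  define Y where "Y = top_of_set (\<Phi> ` topspace X)"
  define S :: "(nat \<Rightarrow> complex) \<Rightarrow> (nat \<Rightarrow> complex)" where "S = (\<lambda>y n. y (Suc n))"
  have comm: "\<Phi> (T x) = S (\<Phi> x)" for x
    by (simp add: \<Phi>_def S_def funpow_swap1)
  have \<Phi>_euc: "continuous_map X euclidean \<Phi>"
    unfolding euclidean_product_topology[symmetric] continuous_map_componentwise_UNIV \<Phi>_def
    using continuous_map_compose[OF continuous_map_funpow[OF T] F] by (simp add: o_def)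
  then have \<Phi>: "continuous_map X Y \<Phi>"
    unfolding Y_def by (simp add: continuous_map_in_subtopology)
  have topY: "topspace Y = \<Phi> ` topspace X"
    by (simp add: Y_def)
  have Y: "compact_space Y"
    unfolding Y_def using X \<Phi>_euc
    by (intro compact_space_subtopology image_compactin[where X = X]) (auto simp: compact_space_def)
  have "Hausdorff_space Y"
    unfolding Y_def by (intro Hausdorff_space_subtopology) simp
  have "continuous_on UNIV S"
    unfolding S_def by (intro continuous_on_coordinatewise_then_product continuous_on_product_coordinates)
  moreover have "S ` topspace Y \<subseteq> topspace Y"
    using comm continuous_map_funspace[OF T] unfolding topY by (auto simp: image_iff) (metis PiE)
  ultimately have S: "continuous_map Y Y S"
    unfolding Y_def by (auto intro: continuous_on_subset)
  have "topspace X \<noteq> {}" using x0 by blast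
  then have "topological_entropy Y S \<le> 0"
    using topological_entropy_factor[where \<Phi> = \<Phi>, OF X _ Y T S \<Phi> topY[symmetric]] comm ent
    by metis
  then have "topological_entropy Y S = 0"
    using topological_entropy_nonneg[of Y S] by (rule antisym)
  moreover have "\<Phi> x0 \<in> topspace Y" using x0 topY by blast
  moreover have "continuous_map Y euclidean (\<lambda>y. y 0)"
    unfolding Y_def by (auto intro: continuous_on_subset[OF continuous_on_product_coordinates])
  moreover have "(S ^^ n) y m = y (n + m)" for n m y
    by (induction n arbitrary: m) (auto simp: S_def)
  then have "\<xi> n = ((S ^^ n) (\<Phi> x0)) 0" for n
    by (simp add: \<xi> \<Phi>_def)
  ultimately have "deterministic_on Y \<xi>"
    unfolding deterministic_on_def using Y \<open>Hausdorff_space Y\<close> S by blast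
  then show ?thesis unfolding deterministic_def by blast
qed

definition moebius_mu :: "nat \<Rightarrow> int" where
  "moebius_mu n = (if squarefree n then (-1) ^ card (prime_factors n) else 0)"

definition sarnak_conjecture :: bool where
  "sarnak_conjecture \<longleftrightarrow>
     (\<forall>\<xi>. deterministic \<xi> \<longrightarrow>
        (\<lambda>N. (\<Sum>n=1..N. of_int (moebius_mu n) * \<xi> n) / of_nat N) \<longlonglongrightarrow> 0)"

definition e2pi :: "real \<Rightarrow> complex" where
  "e2pi x = exp (2 * of_real pi * \<i> * of_real x)"

definition dist_nearest_int :: "real \<Rightarrow> real" where
  "dist_nearest_int x = infdist x \<int>"

definition forward_diff :: "(nat \<Rightarrow> real) \<Rightarrow> nat \<Rightarrow> real" where
  "forward_diff f n = f (n + 1) - f n"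

end

theory Submission
  imports Defs
begin

text \<open>A bounded sequence is deterministic iff, up to a fixed precision, its windows of length \<open>L\<close>
  fall into \<open>exp (o(L))\<close> classes, where for each \<open>L\<close> finitely many starting points may be ignored.
  For the phases \<open>e(f(n))\<close> with \<open>f \<in> D\<close> a precision polynomial in \<open>1/L\<close> is carried along, since it
  survives discrete integration: a window of \<open>e(f)\<close> is determined by its first value and the
  corresponding window of \<open>e(\<Delta>f)\<close>, at the cost of one factor \<open>L\<close>. As polynomials are annihilated by
  some \<open>\<Delta>^d\<close> and indicators of deterministic sets have few exact windows, \<open>g\<close> and then, integrating
  \<open>k\<close> times, all of \<open>D\<close> have subexponentially many windows.

  If the average over blocks did not tend to \<open>0\<close>, choose disjoint blocks whose lengths grow to
  infinity, and on each block an \<open>f \<in> D\<close> and a constant phase making the block sum equal to its modulus.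
  A window of fixed length far out meets at most two blocks, so the sequence obtained by pasting
  is still deterministic; its large correlation with \<open>\<mu>\<close> contradicts Sarnak's conjecture.\<close>

section \<open>Window classes\<close>

text \<open>The threshold \<open>N\<close> does not count towards the number of classes: for fixed \<open>L\<close> it may be
  arbitrarily large. This loses nothing, because long windows are cut into windows of length \<open>L\<close>
  with one and the same \<open>N\<close>, see \<open>finite_window_centers\<close>.\<close>

definition partitioned :: "('i \<Rightarrow> nat \<Rightarrow> 'i \<Rightarrow> nat \<Rightarrow> bool) \<Rightarrow> real \<Rightarrow> bool" where
  "partitioned R r \<longleftrightarrow> (\<exists>N (C :: nat set) \<kappa>. finite C \<and> real (card C) \<le> r \<and>
     (\<forall>a. \<forall>n\<ge>N. \<kappa> a n \<in> C) \<and> (\<forall>a b. \<forall>m\<ge>N. \<forall>n\<ge>N. \<kappa> a m = \<kappa> b n \<longrightarrow> R a m b n))"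

definition subexponential :: "(nat \<Rightarrow> 'i \<Rightarrow> nat \<Rightarrow> 'i \<Rightarrow> nat \<Rightarrow> bool) \<Rightarrow> bool" where
  "subexponential R \<longleftrightarrow> (\<forall>\<delta>>0. \<forall>\<^sub>F L in sequentially. partitioned (R L) (exp (\<delta> * real L)))"

text \<open>The tolerance may depend on the window length \<open>L\<close>. The two windows carry
  separate indices \<open>a\<close> and \<open>b\<close>, so one set of classes has to serve the
  whole family at once.\<close>

definition close :: "('i \<Rightarrow> nat \<Rightarrow> complex) \<Rightarrow> (nat \<Rightarrow> real) \<Rightarrow> nat \<Rightarrow> 'i \<Rightarrow> nat \<Rightarrow> 'i \<Rightarrow> nat \<Rightarrow> bool" where
  "close \<theta> r L a m b n \<longleftrightarrow> (\<forall>i<L. cmod (\<theta> a (m + i) - \<theta> b (n + i)) \<le> r L)"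

text \<open>Labels in \<open>partitioned\<close> are natural numbers because a definition cannot
  quantify existentially over types; renumbering admits labels of any type, such as words or cover
  elements.\<close>

lemma partitionedI:
  fixes C :: "'c set"
  assumes C: "finite C" "real (card C) \<le> r"
    and \<kappa>: "\<And>a n. n \<ge> N \<Longrightarrow> \<kappa> a n \<in> C"
    and R: "\<And>a b m n. m \<ge> N \<Longrightarrow> n \<ge> N \<Longrightarrow> \<kappa> a m = \<kappa> b n \<Longrightarrow> R a m b n"
  shows "partitioned R r"
proof -
  obtain h :: "'c \<Rightarrow> nat" where h: "bij_betw h C {0..<card C}"
    using ex_bij_betw_finite_nat[OF C(1)] by blast
  have "h (\<kappa> a m) = h (\<kappa> b n) \<longleftrightarrow> \<kappa> a m = \<kappa> b n" if "m \<ge> N" "n \<ge> N" for a b m n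
    using bij_betw_imp_inj_on[OF h] \<kappa>[OF that(1)] \<kappa>[OF that(2)] by (auto dest: inj_onD)
  moreover have "h (\<kappa> a n) \<in> {0..<card C}" if "n \<ge> N" for a n
    using bij_betwE[OF h] \<kappa>[OF that] by blast
  ultimately show ?thesis
    unfolding partitioned_def using C(2) R
    by (intro exI[of _ N] exI[of _ "{0..<card C}"] exI[of _ "\<lambda>a n. h (\<kappa> a n)"]) auto
qed

lemma partitioned_conj:
  assumes "partitioned R r" "partitioned Q s"
  shows "partitioned (\<lambda>a m b n. R a m b n \<and> Q a m b n) (r * s)"
proof -
  obtain N C \<kappa> where 1: "finite (C :: nat set)" "real (card C) \<le> r"
    "\<And>a n. n \<ge> N \<Longrightarrow> \<kappa> a n \<in> C"
    "\<And>a b m n. m \<ge> N \<Longrightarrow> n \<ge> N \<Longrightarrow> \<kappa> a m = \<kappa> b n \<Longrightarrow> R a m b n"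
    using assms(1) unfolding partitioned_def by metis
  obtain N' C' \<kappa>' where 2: "finite (C' :: nat set)" "real (card C') \<le> s"
    "\<And>a n. n \<ge> N' \<Longrightarrow> \<kappa>' a n \<in> C'"
    "\<And>a b m n. m \<ge> N' \<Longrightarrow> n \<ge> N' \<Longrightarrow> \<kappa>' a m = \<kappa>' b n \<Longrightarrow> Q a m b n"
    using assms(2) unfolding partitioned_def by metis
  show ?thesis
  proof (rule partitionedI[where C = "C \<times> C'" and N = "max N N'" and \<kappa> = "\<lambda>a n. (\<kappa> a n, \<kappa>' a n)"])
    show "real (card (C \<times> C')) \<le> r * s"
      using 1(2) 2(2) by (auto simp: card_cartesian_product intro!: mult_mono)
  qed (use 1 2 in auto)
qed

lemma subexponential_conj:
  assumes "subexponential R" "subexponential Q"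
  shows "subexponential (\<lambda>L a m b n. R L a m b n \<and> Q L a m b n)"
  unfolding subexponential_def
proof (intro allI impI)
  fix \<delta> :: real assume "\<delta> > 0"
  then have "\<forall>\<^sub>F L in sequentially. partitioned (R L) (exp (\<delta> / 2 * real L))"
    "\<forall>\<^sub>F L in sequentially. partitioned (Q L) (exp (\<delta> / 2 * real L))"
    using assms unfolding subexponential_def by (meson half_gt_zero)+
  then show "\<forall>\<^sub>F L in sequentially.
      partitioned (\<lambda>a m b n. R L a m b n \<and> Q L a m b n) (exp (\<delta> * real L))"
  proof eventually_elim
    case (elim L)
    show ?case using partitioned_conj[OF elim] by (simp flip: exp_add)
  qed
qed

text \<open>The implication is required only from a threshold on that may depend on
  \<open>L\<close>: this is the freedom that \<open>partitioned\<close> grants, and the way in which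
  asymptotic hypotheses enter.\<close>

lemma subexponential_weaken:
  assumes R: "subexponential R"
    and imp: "\<forall>\<^sub>F L in sequentially. \<exists>N. \<forall>a b. \<forall>m\<ge>N. \<forall>n\<ge>N. R L a m b n \<longrightarrow> Q L a m b n"
  shows "subexponential Q"
  unfolding subexponential_def
proof (intro allI impI)
  fix \<delta> :: real assume "\<delta> > 0"
  then have "\<forall>\<^sub>F L in sequentially. partitioned (R L) (exp (\<delta> * real L))"
    using R unfolding subexponential_def by blast
  with imp show "\<forall>\<^sub>F L in sequentially. partitioned (Q L) (exp (\<delta> * real L))"
  proof eventually_elim
    case (elim L)
    obtain N where N: "\<And>a b m n. m \<ge> N \<Longrightarrow> n \<ge> N \<Longrightarrow> R L a m b n \<Longrightarrow> Q L a m b n"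
      using elim(1) by blast
    obtain N' C \<kappa> where 1: "finite (C :: nat set)" "real (card C) \<le> exp (\<delta> * real L)"
      "\<And>a n. n \<ge> N' \<Longrightarrow> \<kappa> a n \<in> C"
      "\<And>a b m n. m \<ge> N' \<Longrightarrow> n \<ge> N' \<Longrightarrow> \<kappa> a m = \<kappa> b n \<Longrightarrow> R L a m b n"
      using elim(2) unfolding partitioned_def by metis
    show ?case
      by (rule partitionedI[where C = C and N = "max N N'" and \<kappa> = \<kappa>]) (use 1 N in auto)
  qed
qed

text \<open>The square of \<open>5 * L ^ A\<close> dominates both polynomial counts below: grid
  cells for a point of the unit disc and, with \<open>A = 1\<close>, pairs of cut positions in a
  window.\<close>

lemma eventually_poly_le_exp:
  assumes "\<delta> > 0"
  shows "\<forall>\<^sub>F L in sequentially. (5 * real L ^ A) ^ 2 \<le> exp (\<delta> * real L)"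
proof -
  have "((\<lambda>x. 25 * (x ^ (2 * A) / exp x) * (1 / \<delta>) ^ (2 * A)) \<longlongrightarrow> 25 * 0 * (1 / \<delta>) ^ (2 * A)) at_top"
    by (intro tendsto_intros tendsto_power_div_exp_0)
  moreover have "filterlim (\<lambda>L. \<delta> * real L) at_top sequentially"
    using assms by (intro filterlim_tendsto_pos_mult_at_top[OF tendsto_const] filterlim_real_sequentially) auto
  ultimately have "(\<lambda>L. 25 * ((\<delta> * real L) ^ (2 * A) / exp (\<delta> * real L)) * (1 / \<delta>) ^ (2 * A)) \<longlonglongrightarrow> 0"
    using filterlim_compose by fastforce
  then have "\<forall>\<^sub>F L in sequentially.
      25 * ((\<delta> * real L) ^ (2 * A) / exp (\<delta> * real L)) * (1 / \<delta>) ^ (2 * A) < 1"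
    by (rule order_tendstoD) simp
  then show ?thesis
  proof eventually_elim
    case (elim L)
    have "(5 * real L ^ A) ^ 2 = 25 * (\<delta> * real L) ^ (2 * A) * (1 / \<delta>) ^ (2 * A)"
      using assms by (simp add: power_mult_distrib power_divide power_mult mult.commute flip: power_mult)
    with elim show ?case by (simp add: field_simps)
  qed
qed

text \<open>A square grid of mesh comparable to \<open>1 / L ^ A\<close> has polynomially many cells
  over the unit disc, and polynomial growth is subexponential.\<close>

lemma subexponential_point:
  fixes z :: "'i \<Rightarrow> nat \<Rightarrow> complex"
  assumes z: "\<And>a n. cmod (z a n) \<le> 1"
  shows "subexponential (\<lambda>L a m b n. cmod (z a m - z b n) \<le> 1 / real L ^ A)"
  unfolding subexponential_def
proof (intro allI impI)
  fix \<delta> :: real assume "\<delta> > 0"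
  show "\<forall>\<^sub>F L in sequentially.
      partitioned (\<lambda>a m b n. cmod (z a m - z b n) \<le> 1 / real L ^ A) (exp (\<delta> * real L))"
    using eventually_poly_le_exp[OF \<open>\<delta> > 0\<close>, of A] eventually_gt_at_top[of 0]
  proof eventually_elim
    case (elim L)
    \<comment> \<open>Mesh \<open>1 / Q\<close> in each coordinate gives distance at most
      \<open>2 / Q = 1 / L ^ A\<close>; each coordinate has \<open>2 * Q + 1 \<le> 5 * L ^ A\<close>
      possible cells.\<close>
    define Q :: int where "Q = 2 * int L ^ A"
    have Q: "Q \<ge> 2" using elim(2) by (simp add: Q_def)
    define cell where "cell = (\<lambda>x. \<lfloor>real_of_int Q * x\<rfloor>)"
    have cell_range: "cell x \<in> {-Q..Q}" if "\<bar>x\<bar> \<le> 1" for x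
    proof -
      have "real_of_int Q * x \<le> real_of_int Q * 1" "real_of_int Q * (-1) \<le> real_of_int Q * x"
        using that Q by (intro mult_left_mono; simp add: abs_le_iff)+
      then show ?thesis unfolding cell_def by (auto simp: floor_le_iff le_floor_iff)
    qed
    have cell_eq: "\<bar>x - y\<bar> \<le> 1 / real_of_int Q" if "cell x = cell y" for x y
    proof -
      have "\<bar>real_of_int Q * x - real_of_int Q * y\<bar> \<le> 1"
        using that unfolding cell_def by linarith
      then have "real_of_int Q * \<bar>x - y\<bar> \<le> 1"
        using Q by (simp add: abs_mult flip: right_diff_distrib)
      then show ?thesis using Q by (simp add: field_simps)
    qed
    have card: "real (card ({-Q..Q} \<times> {-Q..Q})) \<le> exp (\<delta> * real L)"
    proof -
      have "real (card ({-Q..Q} \<times> {-Q..Q})) = (real_of_int (2 * Q + 1))\<^sup>2"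
        using Q by (simp add: card_cartesian_product power2_eq_square)
      also have "\<dots> \<le> (5 * real L ^ A)\<^sup>2"
        using elim(2) one_le_power[of "real L" A] Q by (intro power_mono) (auto simp: Q_def)
      finally show ?thesis using elim(1) by simp
    qed
    show ?case
    proof (rule partitionedI[where C = "{-Q..Q} \<times> {-Q..Q}" and N = 0
          and \<kappa> = "\<lambda>a n. (cell (Re (z a n)), cell (Im (z a n)))"])
      show "(cell (Re (z a n)), cell (Im (z a n))) \<in> {-Q..Q} \<times> {-Q..Q}" for a n
        using cell_range abs_Re_le_cmod abs_Im_le_cmod z order_trans by blast
    next
      fix a b m n assume "(cell (Re (z a m)), cell (Im (z a m))) = (cell (Re (z b n)), cell (Im (z b n)))"
      then have "\<bar>Re (z a m - z b n)\<bar> \<le> 1 / Q" "\<bar>Im (z a m - z b n)\<bar> \<le> 1 / Q"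
        using cell_eq by simp_all
      then have "cmod (z a m - z b n) \<le> 2 / Q"
        using cmod_le[of "z a m - z b n"] by simp
      then show "cmod (z a m - z b n) \<le> 1 / real L ^ A"
        by (simp add: Q_def)
    qed (use card in auto)
  qed
qed

section \<open>Phases of integrated sequences\<close>

lemma norm_e2pi [simp]: "cmod (e2pi x) = 1"
  by (simp add: e2pi_def norm_exp_eq_Re)

lemma e2pi_add: "e2pi (x + y) = e2pi x * e2pi y"
  by (simp add: e2pi_def algebra_simps exp_add)

lemma e2pi_of_int [simp]: "e2pi (of_int j) = 1"
  using exp_integer_2pi[of "of_int j"] by (simp add: e2pi_def mult_ac)

text \<open>The strict bound yields an integer \<open>j\<close> at distance below \<open>r\<close>
  without showing that the infimum is attained. Removing \<open>j\<close> leaves the phase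
  unchanged, and a chord is no longer than its arc.\<close>

lemma norm_e2pi_minus_one_le:
  assumes "dist_nearest_int x < r"
  shows "cmod (e2pi x - 1) \<le> 2 * pi * r"
proof -
  have ne: "(\<int> :: real set) \<noteq> {}" using Ints_0 by blast
  have "(INF y\<in>\<int>. dist x y) < r"
    using assms ne by (simp add: dist_nearest_int_def infdist_def)
  then obtain y where "y \<in> \<int>" "dist x y < r"
    using cInf_lessD[of "dist x ` \<int>" r] ne by blast
  then obtain j :: int where j: "\<bar>x - of_int j\<bar> < r"
    by (auto simp: dist_real_def elim!: Ints_cases)
  have "e2pi x = e2pi (of_int j) * e2pi (x - of_int j)"
    using e2pi_add[of "of_int j" "x - of_int j"] by (simp del: e2pi_of_int)
  then have "cmod (e2pi x - 1) = cmod (exp (\<i> * of_real (2 * pi * (x - of_int j))) - 1)"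
    by (simp add: e2pi_def mult_ac)
  also have "\<dots> \<le> \<bar>2 * pi * (x - of_int j)\<bar>"
    unfolding dist_exp_i_1 using abs_sin_le_one abs_sin_x_le_abs_x[of "2 * pi * (x - of_int j) / 2"]
    by simp
  also have "\<dots> \<le> 2 * pi * r"
    using j by (simp add: abs_mult)
  finally show ?thesis .
qed

lemma norm_mult_diff_le:
  fixes a b c d :: complex
  assumes "cmod a \<le> 1" "cmod d \<le> 1"
  shows "cmod (a * b - c * d) \<le> cmod (b - d) + cmod (a - c)"
proof -
  have "a * b - c * d = a * (b - d) + (a - c) * d" by (simp add: algebra_simps)
  then have "cmod (a * b - c * d) \<le> cmod (a * (b - d)) + cmod ((a - c) * d)"
    by (metis norm_triangle_ineq)
  moreover have "cmod (a * (b - d)) \<le> cmod (b - d)" "cmod ((a - c) * d) \<le> cmod (a - c)"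
    using assms mult_right_mono[of "cmod a" 1 "cmod (b - d)"] mult_left_mono[of "cmod d" 1 "cmod (a - c)"]
    by (simp_all add: norm_mult)
  ultimately show ?thesis by linarith
qed

text \<open>All exponents \<open>A\<close> at once, since an operation below may spend one power of
  \<open>L\<close>: its conclusion for \<open>A\<close> then rests on the hypothesis for
  \<open>Suc A\<close>.\<close>

definition poly_close :: "('i \<Rightarrow> nat \<Rightarrow> real) \<Rightarrow> bool" where
  "poly_close f \<longleftrightarrow> (\<forall>A. subexponential (close (\<lambda>a n. e2pi (f a n)) (\<lambda>L. 1 / real L ^ A)))"

text \<open>The phases telescope: e(f(m+i)) is e(f(m)) times the phases of \<open>i\<close>
  differences. The errors add up to at most \<open>i + 1 \<le> L\<close> times
  \<open>1 / L ^ Suc A\<close>, and the start value costs only polynomially many classes.\<close>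

lemma poly_close_of_forward_diff:
  assumes "poly_close (\<lambda>a. forward_diff (f a))"
  shows "poly_close f"
  unfolding poly_close_def
proof
  fix A
  have "subexponential (close (\<lambda>a n. e2pi (forward_diff (f a) n)) (\<lambda>L. 1 / real L ^ Suc A))"
    using assms unfolding poly_close_def by blast
  moreover have "subexponential
      (\<lambda>L a m b n. cmod (e2pi (f a m) - e2pi (f b n)) \<le> 1 / real L ^ Suc A)"
    by (rule subexponential_point) simp
  ultimately show "subexponential (close (\<lambda>a n. e2pi (f a n)) (\<lambda>L. 1 / real L ^ A))"
  proof (rule subexponential_weaken[OF subexponential_conj], intro eventually_mono[OF eventually_gt_at_top[of 0]] exI[of _ 0] allI impI)
    fix L a b m n
    assume L: "(0 :: nat) < L" and H: "close (\<lambda>a n. e2pi (forward_diff (f a) n)) (\<lambda>L. 1 / real L ^ Suc A) L a m b n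
      \<and> cmod (e2pi (f a m) - e2pi (f b n)) \<le> 1 / real L ^ Suc A"
    have step: "e2pi (f a (Suc m)) = e2pi (f a m) * e2pi (forward_diff (f a) m)" for a m
      by (simp add: forward_diff_def flip: e2pi_add)
    have "i < L \<Longrightarrow> cmod (e2pi (f a (m + i)) - e2pi (f b (n + i))) \<le> real (Suc i) * (1 / real L ^ Suc A)" for i
    proof (induction i)
      case 0
      then show ?case using H by simp
    next
      case (Suc i)
      have "cmod (e2pi (f a (m + Suc i)) - e2pi (f b (n + Suc i)))
        \<le> cmod (e2pi (forward_diff (f a) (m + i)) - e2pi (forward_diff (f b) (n + i)))
          + cmod (e2pi (f a (m + i)) - e2pi (f b (n + i)))"
        unfolding add_Suc_right step by (rule norm_mult_diff_le) simp_all
      also have "\<dots> \<le> 1 / real L ^ Suc A + real (Suc i) * (1 / real L ^ Suc A)"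
        using Suc H unfolding close_def by (intro add_mono) auto
      finally show ?case by (simp add: algebra_simps add_divide_distrib)
    qed
    moreover have "real (Suc i) * (1 / real L ^ Suc A) \<le> 1 / real L ^ A" if "i < L" for i
    proof -
      have "real (Suc i) * (1 / real L ^ Suc A) \<le> real L * (1 / real L ^ Suc A)"
        using that by (intro mult_right_mono) auto
      also have "\<dots> = 1 / real L ^ A" using L by simp
      finally show ?thesis .
    qed
    ultimately show "close (\<lambda>a n. e2pi (f a n)) (\<lambda>L. 1 / real L ^ A) L a m b n"
      unfolding close_def by (meson order_trans)
  qed
qed

lemma poly_close_of_forward_diff_iterate:
  assumes "poly_close (\<lambda>a. (forward_diff ^^ k) (f a))"
  shows "poly_close f"
  using assms
  by (induction k arbitrary: f) (auto simp: funpow_swap1 intro: poly_close_of_forward_diff)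

lemma poly_close_const: "poly_close (\<lambda>_ _. c)"
  unfolding poly_close_def
proof
  fix A
  \<comment> \<open>The zero sequence turns the point lemma into a relation that always holds, which
    is all that a constant phase needs.\<close>
  have "subexponential (\<lambda>L a m b n. cmod (0 - 0 :: complex) \<le> 1 / real L ^ A)"
    by (rule subexponential_point) simp
  then show "subexponential (close (\<lambda>a n. e2pi c) (\<lambda>L. 1 / real L ^ A))"
    by (rule subexponential_weaken) (simp add: close_def)
qed

text \<open>Leading terms cancel in p(y+1) - p(y), so the difference is zero or of smaller degree;
  for constant \<open>p\<close> it is zero, and there the induction ends.\<close>

lemma poly_close_poly: "poly_close (\<lambda>(_ :: 'i) n. poly p (real n))"
proof (induction "degree p" arbitrary: p rule: less_induct)
  case less
  define q where "q = pcompose p [:1, 1:] - p"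
  have "coeff q (degree p) = 0"
    using lead_coeff_comp[of "[:1, 1 :: real:]" p] by (simp add: q_def degree_pcompose)
  moreover have "degree q \<le> degree p"
    unfolding q_def by (rule degree_diff_le) (simp_all add: degree_pcompose)
  ultimately have q: "q = 0 \<or> degree q < degree p"
    by (simp add: eq_zero_or_degree_less)
  have "forward_diff (\<lambda>n. poly p (real n)) = (\<lambda>n. poly q (real n))"
    by (auto simp: forward_diff_def q_def poly_pcompose algebra_simps)
  moreover have "poly_close (\<lambda>(_ :: 'i) n. poly q (real n))"
    using q
  proof
    assume "q = 0"
    then show ?thesis using poly_close_const[of 0] by simp
  qed (rule less)
  ultimately have "poly_close (\<lambda>_ :: 'i. forward_diff (\<lambda>n. poly p (real n)))"
    by simp
  then show ?case
    by (rule poly_close_of_forward_diff)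
qed

lemma poly_close_add:
  assumes "poly_close f" "poly_close g"
  shows "poly_close (\<lambda>a n. f a n + g a n)"
  unfolding poly_close_def
proof
  fix A
  have "subexponential (close (\<lambda>a n. e2pi (f a n)) (\<lambda>L. 1 / real L ^ Suc A))"
    "subexponential (close (\<lambda>a n. e2pi (g a n)) (\<lambda>L. 1 / real L ^ Suc A))"
    using assms unfolding poly_close_def by blast+
  then show "subexponential (close (\<lambda>a n. e2pi (f a n + g a n)) (\<lambda>L. 1 / real L ^ A))"
  proof (rule subexponential_weaken[OF subexponential_conj], intro eventually_mono[OF eventually_ge_at_top[of 2]] exI[of _ 0] allI impI)
    fix L a b m n
    assume L: "(2 :: nat) \<le> L" and H: "close (\<lambda>a n. e2pi (f a n)) (\<lambda>L. 1 / real L ^ Suc A) L a m b n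
      \<and> close (\<lambda>a n. e2pi (g a n)) (\<lambda>L. 1 / real L ^ Suc A) L a m b n"
    show "close (\<lambda>a n. e2pi (f a n + g a n)) (\<lambda>L. 1 / real L ^ A) L a m b n"
      unfolding close_def
    proof (intro allI impI)
      fix i assume i: "i < L"
      have "cmod (e2pi (f a (m + i) + g a (m + i)) - e2pi (f b (n + i) + g b (n + i)))
        \<le> cmod (e2pi (g a (m + i)) - e2pi (g b (n + i))) + cmod (e2pi (f a (m + i)) - e2pi (f b (n + i)))"
        unfolding e2pi_add by (rule norm_mult_diff_le) simp_all
      also have "\<dots> \<le> 1 / real L ^ Suc A + 1 / real L ^ Suc A"
        using i H unfolding close_def by (intro add_mono) auto
      also have "\<dots> = 2 * (1 / real L ^ Suc A)" by simp
      also have "\<dots> \<le> real L * (1 / real L ^ Suc A)"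
        using L by (intro mult_right_mono) auto
      also have "\<dots> = 1 / real L ^ A" using L by simp
      finally show "cmod (e2pi (f a (m + i) + g a (m + i)) - e2pi (f b (n + i) + g b (n + i))) \<le> 1 / real L ^ A" .
    qed
  qed
qed

lemma poly_close_sum:
  assumes "finite V" "\<And>v. v \<in> V \<Longrightarrow> poly_close (f v)"
  shows "poly_close (\<lambda>a n. \<Sum>v\<in>V. f v a n)"
  using assms by (induction V) (simp_all add: poly_close_const poly_close_add)

text \<open>Indicator values within 1/2 of each other agree, so equivalent windows meet
  \<open>S\<close> in the same pattern: on \<open>S\<close> the phases are those of
  \<open>f\<close>, elsewhere both are 1. A fixed precision for \<open>S\<close> therefore suffices,
  while the phases of \<open>f\<close> keep their polynomial one.\<close>

lemma poly_close_indicator_mult: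
  fixes f :: "'i \<Rightarrow> nat \<Rightarrow> real"
  assumes f: "poly_close f" and S: "subexponential (close (\<lambda>_ :: 'i. indicator S) (\<lambda>_. 1 / 2))"
  shows "poly_close (\<lambda>a n. indicator S n * f a n)"
  unfolding poly_close_def
proof
  fix A
  have "subexponential (close (\<lambda>a n. e2pi (f a n)) (\<lambda>L. 1 / real L ^ A))"
    using f unfolding poly_close_def by blast
  from this S show "subexponential (close (\<lambda>a n. e2pi (indicator S n * f a n)) (\<lambda>L. 1 / real L ^ A))"
  proof (rule subexponential_weaken[OF subexponential_conj], intro always_eventually exI[of _ 0] allI impI)
    fix L a b m n
    assume H: "close (\<lambda>a n. e2pi (f a n)) (\<lambda>L. 1 / real L ^ A) L a m b n
      \<and> close (\<lambda>_. indicator S) (\<lambda>_. 1 / 2) L a m b n"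
    show "close (\<lambda>a n. e2pi (indicator S n * f a n)) (\<lambda>L. 1 / real L ^ A) L a m b n"
      unfolding close_def
    proof (intro allI impI)
      fix i assume i: "i < L"
      have "cmod (indicator S (m + i) - indicator S (n + i)) \<le> 1 / 2"
        using H i unfolding close_def by blast
      then have "m + i \<in> S \<longleftrightarrow> n + i \<in> S"
        by (cases "m + i \<in> S"; cases "n + i \<in> S") auto
      then show "cmod (e2pi (indicator S (m + i) * f a (m + i)) - e2pi (indicator S (n + i) * f b (n + i)))
          \<le> 1 / real L ^ A"
        using H i unfolding close_def by (auto simp: indicator_def)
    qed
  qed
qed

text \<open>The required precision depends on \<open>L\<close>, hence so does the point from which
  \<open>f\<close> and \<open>g\<close> agree to it; the thresholds in \<open>partitioned\<close>
  absorb this without any rate of convergence. Passing through the two windows of \<open>g\<close>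
  adds three errors, whence \<open>L \<ge> 3\<close>.\<close>

lemma poly_close_asymptotic:
  assumes g: "poly_close g"
    and fg: "\<And>r. r > 0 \<Longrightarrow> \<forall>\<^sub>F n in sequentially. \<forall>a. dist_nearest_int (f a n - g a n) < r"
  shows "poly_close f"
  unfolding poly_close_def
proof
  fix A
  have "subexponential (close (\<lambda>a n. e2pi (g a n)) (\<lambda>L. 1 / real L ^ Suc A))"
    using g unfolding poly_close_def by blast
  then show "subexponential (close (\<lambda>a n. e2pi (f a n)) (\<lambda>L. 1 / real L ^ A))"
  proof (rule subexponential_weaken, intro eventually_mono[OF eventually_ge_at_top[of 3]])
    fix L :: nat assume L: "3 \<le> L"
    \<comment> \<open>Chosen so that \<open>2 * pi * r = 1 / L ^ Suc A\<close>.\<close>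
    define r where "r = 1 / real L ^ Suc A / (2 * pi)"
    have "r > 0" using L by (simp add: r_def)
    from fg[OF this] obtain N where N: "\<And>n a. n \<ge> N \<Longrightarrow> dist_nearest_int (f a n - g a n) < r"
      unfolding eventually_sequentially by blast
    have near: "cmod (e2pi (f a n) - e2pi (g a n)) \<le> 1 / real L ^ Suc A" if "n \<ge> N" for a n
    proof -
      have "e2pi (f a n) - e2pi (g a n) = e2pi (g a n) * (e2pi (f a n - g a n) - 1)"
        by (simp add: right_diff_distrib flip: e2pi_add)
      then have "cmod (e2pi (f a n) - e2pi (g a n)) = cmod (e2pi (f a n - g a n) - 1)"
        by (simp add: norm_mult)
      also have "\<dots> \<le> 2 * pi * r" by (rule norm_e2pi_minus_one_le[OF N[OF that]])
      finally show ?thesis by (simp add: r_def)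
    qed
    show "\<exists>N. \<forall>a b. \<forall>m\<ge>N. \<forall>n\<ge>N. close (\<lambda>a n. e2pi (g a n)) (\<lambda>L. 1 / real L ^ Suc A) L a m b n
      \<longrightarrow> close (\<lambda>a n. e2pi (f a n)) (\<lambda>L. 1 / real L ^ A) L a m b n"
    proof (intro exI[of _ N] allI impI)
      fix a b m n assume mn: "m \<ge> N" "n \<ge> N"
        and H: "close (\<lambda>a n. e2pi (g a n)) (\<lambda>L. 1 / real L ^ Suc A) L a m b n"
      show "close (\<lambda>a n. e2pi (f a n)) (\<lambda>L. 1 / real L ^ A) L a m b n"
        unfolding close_def
      proof (intro allI impI)
        fix i assume i: "i < L"
        have tri: "cmod (u - x) \<le> cmod (u - v) + cmod (v - w) + cmod (x - w)" for u v w x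
          using norm_triangle_ineq[of "u - v" "v - x"] norm_triangle_ineq[of "v - w" "w - x"]
          by (simp add: norm_minus_commute)
        have "cmod (e2pi (f a (m + i)) - e2pi (f b (n + i)))
          \<le> 1 / real L ^ Suc A + 1 / real L ^ Suc A + 1 / real L ^ Suc A"
          by (rule order_trans[OF tri add_mono[OF add_mono]], rule near)
             (use mn i H near in \<open>auto simp: close_def\<close>)
        also have "\<dots> = 3 * (1 / real L ^ Suc A)" by simp
        also have "\<dots> \<le> real L * (1 / real L ^ Suc A)"
          using L by (intro mult_right_mono) auto
        also have "\<dots> = 1 / real L ^ A" using L by simp
        finally show "cmod (e2pi (f a (m + i)) - e2pi (f b (n + i))) \<le> 1 / real L ^ A" .
      qed
    qed
  qed
qed

section \<open>Window counts of deterministic sequences\<close>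

lemma deterministic_bounded:
  assumes "deterministic \<xi>"
  obtains B where "B \<ge> 1" "\<And>n. cmod (\<xi> n) \<le> B"
proof -
  obtain X :: "(nat \<Rightarrow> complex) topology" and T x0 F where X: "compact_space X"
    and T: "continuous_map X X T" and x0: "x0 \<in> topspace X"
    and F: "continuous_map X euclidean F" and \<xi>: "\<And>n. \<xi> n = F ((T ^^ n) x0)"
    using assms unfolding deterministic_def deterministic_on_def by blast
  have "compactin euclidean (F ` topspace X)"
    using X F by (intro image_compactin[where X = X]) (auto simp: compact_space_def)
  then have "bounded (F ` topspace X)" by (simp add: compact_imp_bounded)
  then obtain B where B: "\<And>x. x \<in> topspace X \<Longrightarrow> cmod (F x) \<le> B"
    unfolding bounded_iff by auto
  have "cmod (\<xi> n) \<le> max B 1" for n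
    using B[OF funpow_in_topspace[OF T x0, of n]] by (simp add: \<xi>)
  then show thesis by (intro that[of "max B 1"]) auto
qed

text \<open>The classes are the members of a minimal subcover of the refinement of the cover by
  preimages of balls of radius \<epsilon>/2. Zero entropy bounds their number, and two orbit points
  in one member have values of \<open>F\<close> in a common ball at each of the \<open>n\<close>
  times.\<close>

lemma deterministic_imp_subexponential:
  assumes "deterministic \<xi>" "\<epsilon> > 0"
  shows "subexponential (close (\<lambda>_ :: 'i. \<xi>) (\<lambda>_. \<epsilon>))"
  unfolding subexponential_def
proof (intro allI impI)
  fix \<delta> :: real assume \<delta>: "\<delta> > 0"
  obtain X :: "(nat \<Rightarrow> complex) topology" and T x0 F where X: "compact_space X"
    and T: "continuous_map X X T" and ent: "topological_entropy X T = 0" and x0: "x0 \<in> topspace X"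
    and F: "continuous_map X euclidean F" and \<xi>: "\<And>n. \<xi> n = F ((T ^^ n) x0)"
    using assms unfolding deterministic_def deterministic_on_def by blast
  define U where "U = range (\<lambda>z. {x \<in> topspace X. F x \<in> ball z (\<epsilon> / 2)})"
  have U: "open_cover X U"
    unfolding open_cover_def
  proof (intro conjI ballI equalityI subsetI)
    fix A assume "A \<in> U"
    then obtain z where "A = {x \<in> topspace X. F x \<in> ball z (\<epsilon> / 2)}" unfolding U_def by blast
    then show "openin X A" using openin_continuous_map_preimage[OF F, of "ball z (\<epsilon> / 2)"] by simp
  next
    fix x assume "x \<in> topspace X"
    moreover have "F x \<in> ball (F x) (\<epsilon> / 2)" using \<open>\<epsilon> > 0\<close> by simp
    ultimately show "x \<in> \<Union>U" unfolding U_def by blast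
  qed (auto simp: U_def)
  define K where "K = (\<lambda>n. min_subcover_card X (cover_refinement X T U n))"
  have "cover_entropy X T U \<le> 0"
    unfolding ent[symmetric] topological_entropy_def using U by (intro SUP_upper) simp
  then have "limsup (\<lambda>n. ereal (ln (real (K n)) / real n)) < ereal \<delta>"
    using \<delta> unfolding cover_entropy_def K_def zero_ereal_def by (meson ereal_less_eq(3) le_less_trans less_ereal.simps(1))
  then have "\<forall>\<^sub>F n in sequentially. ereal (ln (real (K n)) / real n) < ereal \<delta>"
    by (rule Limsup_lessD)
  then show "\<forall>\<^sub>F n in sequentially. partitioned (close (\<lambda>_ :: 'i. \<xi>) (\<lambda>_. \<epsilon>) n) (exp (\<delta> * real n))"
    using eventually_gt_at_top[of 0]
  proof eventually_elim
    case (elim n)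
    obtain V where V: "V \<subseteq> cover_refinement X T U n" "finite V" "\<Union>V = topspace X" "card V = K n"
      unfolding K_def by (rule min_subcover_card_attained[OF X open_cover_refinement[OF T U]])
    have "K n > 0"
      unfolding K_def using x0 by (intro min_subcover_card_pos X open_cover_refinement[OF T U]) auto
    moreover have "ln (real (K n)) \<le> \<delta> * real n"
      using elim by (simp add: field_simps)
    ultimately have card: "real (card V) \<le> exp (\<delta> * real n)"
      using V(4) by (metis exp_le_cancel_iff exp_ln of_nat_0_less_iff)
    have "\<exists>B. B \<in> V \<and> (T ^^ m) x0 \<in> B" for m
      using V(3) funpow_in_topspace[OF T x0, of m] by blast
    then obtain \<kappa> where \<kappa>: "\<And>m. \<kappa> m \<in> V" "\<And>m. (T ^^ m) x0 \<in> \<kappa> m" by metis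
    show ?case
    proof (rule partitionedI[where C = V and N = 0 and \<kappa> = "\<lambda>_. \<kappa>"])
      fix a b :: 'i and m m' assume eq: "\<kappa> m = \<kappa> m'"
      obtain A where A: "\<kappa> m = {x \<in> topspace X. \<forall>i<n. (T ^^ i) x \<in> A i}" "\<forall>i<n. A i \<in> U"
        using \<kappa>(1)[of m] V(1) unfolding cover_refinement_def by blast
      show "close (\<lambda>_. \<xi>) (\<lambda>_. \<epsilon>) n a m b m'"
        unfolding close_def
      proof (intro allI impI)
        fix i assume i: "i < n"
        obtain z where z: "A i = {x \<in> topspace X. F x \<in> ball z (\<epsilon> / 2)}"
          using A(2) i unfolding U_def by blast
        have "\<xi> (k + i) \<in> ball z (\<epsilon> / 2)" if "\<kappa> k = \<kappa> m" for k
        proof -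
          have "(T ^^ i) ((T ^^ k) x0) \<in> A i"
            using \<kappa>(2)[of k] A(1) that i by auto
          then show ?thesis unfolding z \<xi> by (simp add: funpow_add add.commute)
        qed
        from this[OF refl] this[OF eq[symmetric]]
        show "cmod (\<xi> (m + i) - \<xi> (m' + i)) \<le> \<epsilon>"
          using dist_triangle_half_r[of z "\<xi> (m + i)" \<epsilon> "\<xi> (m' + i)"] by (simp add: dist_norm)
      qed
    qed (use V(2) card \<kappa> in auto)
  qed
qed

text \<open>A single length \<open>L\<close> with few classes is fixed, and a window of any length
  \<open>n\<close> is labelled by the word of classes of its consecutive pieces of length
  \<open>L\<close>. The \<open>N\<close> starting points below the threshold become their own
  centers, so \<open>A\<close> absorbs \<open>N\<close> and does not depend on
  \<open>n\<close>.\<close>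

lemma finite_window_centers:
  assumes \<eta>: "subexponential (close (\<lambda>_ :: unit. \<eta>) (\<lambda>_. \<epsilon>))" and "\<delta> > 0"
  shows "\<exists>A\<ge>1. \<forall>n. \<exists>Z. finite Z \<and> real (card Z) \<le> A * exp (\<delta> * real n) \<and>
    (\<forall>m. \<exists>z\<in>Z. \<forall>i<n. cmod (\<eta> (m + i) - \<eta> (z + i)) \<le> \<epsilon>)"
proof -
  have "\<forall>\<^sub>F L in sequentially. partitioned (close (\<lambda>_ :: unit. \<eta>) (\<lambda>_. \<epsilon>) L) (exp (\<delta> * real L))"
    using assms unfolding subexponential_def by blast
  then have "\<forall>\<^sub>F L in sequentially. partitioned (close (\<lambda>_ :: unit. \<eta>) (\<lambda>_. \<epsilon>) L) (exp (\<delta> * real L)) \<and> L > 0"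
    by (intro eventually_conj eventually_gt_at_top)
  then obtain L where L: "L > 0" "partitioned (close (\<lambda>_ :: unit. \<eta>) (\<lambda>_. \<epsilon>) L) (exp (\<delta> * real L))"
    unfolding eventually_sequentially by blast
  obtain N C \<kappa>' where C: "finite (C :: nat set)" "real (card C) \<le> exp (\<delta> * real L)"
    and \<kappa>': "\<And>a n. n \<ge> N \<Longrightarrow> \<kappa>' a n \<in> C"
    "\<And>a b m n. m \<ge> N \<Longrightarrow> n \<ge> N \<Longrightarrow> \<kappa>' a m = \<kappa>' b n \<Longrightarrow> close (\<lambda>_ :: unit. \<eta>) (\<lambda>_. \<epsilon>) L a m b n"
    using L(2) unfolding partitioned_def by metis
  define \<kappa> where "\<kappa> = \<kappa>' ()"
  show ?thesis
  proof (intro exI[of _ "real N + exp (\<delta> * real L)"] conjI allI)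
    show "1 \<le> real N + exp (\<delta> * real L)"
      using \<open>\<delta> > 0\<close> by (simp add: add_increasing)
  next
    fix n
    \<comment> \<open>The extra piece covers the incomplete end of the window; it costs one factor
      \<open>exp (\<delta> * L)\<close>, which goes into the constant.\<close>
    define q where "q = n div L + 1"
    have q: "n < q * L"
      using L(1) unfolding q_def by (metis Suc_eq_plus1 dividend_less_div_times mult.commute mult_Suc add.commute)
    define word where "word = (\<lambda>m. map (\<lambda>j. \<kappa> (m + j * L)) [0..<q])"
    define W where "W = {xs. set xs \<subseteq> C \<and> length xs = q}"
    have W: "finite W" "card W = card C ^ q"
      unfolding W_def using C(1) by (simp_all add: finite_lists_length_eq card_lists_length_eq)
    have word: "word m \<in> W" if "m \<ge> N" for m
      using that \<kappa>'(1) unfolding word_def W_def \<kappa>_def by auto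
    have same: "cmod (\<eta> (m + i) - \<eta> (m' + i)) \<le> \<epsilon>"
      if "m \<ge> N" "m' \<ge> N" "word m = word m'" "i < n" for m m' i
    proof -
      have "i div L < q"
        using q that(4) L(1) by (metis less_mult_imp_div_less order.strict_trans)
      then have "\<kappa> (m + i div L * L) = \<kappa> (m' + i div L * L)"
        using arg_cong[OF that(3), of "\<lambda>xs. xs ! (i div L)"] unfolding word_def by simp
      then have "close (\<lambda>_ :: unit. \<eta>) (\<lambda>_. \<epsilon>) L () (m + i div L * L) () (m' + i div L * L)"
        using that(1,2) unfolding \<kappa>_def by (intro \<kappa>'(2)) auto
      then have "cmod (\<eta> (m + i div L * L + i mod L) - \<eta> (m' + i div L * L + i mod L)) \<le> \<epsilon>"
        using mod_less_divisor[OF L(1), of i] unfolding close_def by blast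
      then show ?thesis by (simp add: add.assoc)
    qed
    define rep where "rep = (\<lambda>x. SOME m. m \<ge> N \<and> word m = x)"
    have rep: "rep (word m) \<ge> N \<and> word (rep (word m)) = word m" if "m \<ge> N" for m
      unfolding rep_def using someI[of "\<lambda>k. k \<ge> N \<and> word k = word m" m] that by blast
    show "\<exists>Z. finite Z \<and> real (card Z) \<le> (real N + exp (\<delta> * real L)) * exp (\<delta> * real n) \<and>
      (\<forall>m. \<exists>z\<in>Z. \<forall>i<n. cmod (\<eta> (m + i) - \<eta> (z + i)) \<le> \<epsilon>)"
    proof (intro exI[of _ "{..<N} \<union> rep ` W"] conjI allI)
      show "finite ({..<N} \<union> rep ` W)" using W by simp
      have "card ({..<N} \<union> rep ` W) \<le> N + card W"
        by (rule order_trans[OF card_Un_le]) (use card_image_le[OF W(1)] in simp)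
      then have "real (card ({..<N} \<union> rep ` W)) \<le> real N + real (card W)"
        by (simp flip: of_nat_add)
      also have "real (card W) \<le> exp (\<delta> * real L) ^ q"
        unfolding W(2) of_nat_power by (intro power_mono C(2)) simp
      also have "exp (\<delta> * real L) ^ q \<le> exp (\<delta> * real L) * exp (\<delta> * real n)"
      proof -
        have "real (q * L) \<le> real (L + n)"
          unfolding q_def by (intro of_nat_mono) (simp add: algebra_simps)
        then have "\<delta> * (real q * real L) \<le> \<delta> * real L + \<delta> * real n"
          using mult_left_mono[of "real q * real L" "real L + real n" \<delta>] \<open>\<delta> > 0\<close>
          by (simp add: distrib_left)
        then show ?thesis by (simp add: mult_ac flip: exp_add exp_of_nat_mult)
      qed
      also have "real N + exp (\<delta> * real L) * exp (\<delta> * real n)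
          \<le> (real N + exp (\<delta> * real L)) * exp (\<delta> * real n)"
        using \<open>\<delta> > 0\<close> mult_left_mono[of 1 "exp (\<delta> * real n)" "real N"] by (simp add: distrib_right)
      finally show "real (card ({..<N} \<union> rep ` W)) \<le> (real N + exp (\<delta> * real L)) * exp (\<delta> * real n)"
        by simp
    next
      fix m
      show "\<exists>z\<in>{..<N} \<union> rep ` W. \<forall>i<n. cmod (\<eta> (m + i) - \<eta> (z + i)) \<le> \<epsilon>"
      proof (cases "m < N")
        case True
        \<comment> \<open>Comparing the window at \<open>N\<close> with itself shows that \<epsilon>
          is nonnegative, as an exact center requires.\<close>
        have "\<epsilon> \<ge> 0"
          using L(1) \<kappa>'(2)[of N N "()" "()"] unfolding close_def by auto
        then show ?thesis using True by (intro bexI[of _ m]) auto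
      next
        case False
        then show ?thesis
          using rep[of m] word[of m] same by (intro bexI[of _ "rep (word m)"]) auto
      qed
    qed
  qed
qed

text \<open>The metric on \<open>nat \<Rightarrow> complex\<close> weights the coordinates
  \<open>from_nat n\<close> geometrically. Twice the largest of the first distances, at most
  \<open>e / 2\<close>, plus the tail \<open>(1 / 2) ^ N < e / 2\<close> stays below
  \<open>e\<close>.\<close>

lemma dist_fun_less_of_coordinates:
  assumes "e > (0 :: real)"
  shows "\<exists>J. \<exists>\<epsilon>>0. \<forall>x y :: nat \<Rightarrow> complex. (\<forall>i<J. cmod (x i - y i) \<le> \<epsilon>) \<longrightarrow> dist x y < e"
proof -
  obtain N where N: "(1 / 2 :: real) ^ N < e / 2"
    using real_arch_pow_inv[of "e / 2" "1 / 2"] assms by auto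
  define J where "J = Suc (Max (from_nat ` {..N}))"
  show ?thesis
  proof (intro exI[of _ J] exI[of _ "e / 4"] conjI allI impI)
    fix x y :: "nat \<Rightarrow> complex"
    assume xy: "\<forall>i<J. cmod (x i - y i) \<le> e / 4"
    have "from_nat n < J" if "n \<le> N" for n
      using that unfolding J_def by (simp add: less_Suc_eq_le)
    then have "dist (x (from_nat n)) (y (from_nat n)) \<le> e / 4" if "n \<le> N" for n
      using xy that by (simp add: dist_norm)
    moreover have "{dist (x (from_nat n)) (y (from_nat n)) |n. n \<le> N} = (\<lambda>n. dist (x (from_nat n)) (y (from_nat n))) ` {..N}"
      by auto
    ultimately have "Max {dist (x (from_nat n)) (y (from_nat n)) |n. n \<le> N} \<le> e / 4"
      by (simp add: Max_le_iff del: le_divide_eq_numeral1)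
    then show "dist x y < e"
      using dist_fun_le_dist_first_terms[of x y N] N by linarith
  qed (use assms in simp)
qed

text \<open>The system is the shift on the closure \<open>K\<close> of the orbit of \<eta> in a
  product of discs, read off through coordinate 0. The shifts of \<eta> are dense in
  \<open>K\<close>, so the finitely many window centers of \<eta> control all of \<open>K\<close>
  and bound its cover numbers.\<close>

lemma subexponential_imp_deterministic:
  assumes bdd: "\<And>n. cmod (\<eta> n) \<le> B"
    and \<eta>: "\<And>\<epsilon>. \<epsilon> > 0 \<Longrightarrow> subexponential (close (\<lambda>_ :: unit. \<eta>) (\<lambda>_. \<epsilon>))"
  shows "deterministic \<eta>"
proof -
  define orb where "orb = (\<lambda>m i. \<eta> (m + i))"
  define K where "K = closure (range orb)"
  define Y where "Y = top_of_set K"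
  define T :: "(nat \<Rightarrow> complex) \<Rightarrow> (nat \<Rightarrow> complex)" where "T = (\<lambda>y n. y (Suc n))"
  have topY: "topspace Y = K" by (simp add: Y_def)
  have funpow_T: "(T ^^ n) y i = y (n + i)" for n y i
    by (induction n arbitrary: i) (auto simp: T_def)
  have T_orb: "(T ^^ n) (orb m) = orb (m + n)" for n m
    by (rule ext) (simp add: funpow_T orb_def ac_simps)
  have orb_K: "orb m \<in> K" for m
    unfolding K_def by (meson closure_subset rangeI subsetD)
  have cont_T: "continuous_on UNIV T"
    unfolding T_def by (intro continuous_on_coordinatewise_then_product continuous_on_product_coordinates)
  have "T ` K \<subseteq> closure (T ` range orb)"
    unfolding K_def by (rule image_closure_subset[OF continuous_on_subset[OF cont_T]])
      (auto simp: closure_subset)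
  also have "\<dots> \<subseteq> K"
    unfolding K_def using T_orb[of 1] by (intro closure_mono) auto
  finally have T_K: "T ` K \<subseteq> K" .
  then have T: "continuous_map Y Y T"
    unfolding Y_def using cont_T by (auto intro: continuous_on_subset)
  have "compactin (product_topology (\<lambda>_. euclidean) UNIV) (PiE UNIV (\<lambda>_ :: nat. cball (0 :: complex) B))"
    by (simp add: compactin_PiE)
  then have P: "compact (PiE UNIV (\<lambda>_ :: nat. cball (0 :: complex) B))"
    by (simp add: euclidean_product_topology)
  have "range orb \<subseteq> PiE UNIV (\<lambda>_ :: nat. cball (0 :: complex) B)"
    using bdd by (auto simp: orb_def)
  then have "K \<subseteq> PiE UNIV (\<lambda>_ :: nat. cball (0 :: complex) B)"
    unfolding K_def by (rule closure_minimal[OF _ compact_imp_closed[OF P]])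
  then have K: "compact K"
    using compact_Int_closed[OF P, of K] unfolding K_def by (simp add: Int_absorb1)
  then have compY: "compact_space Y"
    unfolding Y_def by (simp add: compact_space_subtopology)
  have "cover_entropy Y T U \<le> 0" if U: "open_cover Y U" for U
  proof (rule ereal_le_epsilon2)
    fix \<delta> :: real assume \<delta>: "\<delta> > 0"
    \<comment> \<open>Open sets of the ambient space whose trace on \<open>K\<close> is in
      \<open>U\<close>; the Heine-Borel lemma then supplies a Lebesgue number \<open>e\<close> of
      the cover.\<close>
    define G where "G = {V. open V \<and> K \<inter> V \<in> U}"
    have G: "K \<subseteq> \<Union>G"
    proof
      fix x assume "x \<in> K"
      then obtain A where A: "A \<in> U" "x \<in> A" using U unfolding open_cover_def topY by blast
      then obtain V where "open V" "A = K \<inter> V"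
        using U unfolding open_cover_def Y_def openin_open by blast
      then show "x \<in> \<Union>G" using A unfolding G_def by blast
    qed
    have "open V" if "V \<in> G" for V using that unfolding G_def by simp
    then obtain e where e: "e > 0" "\<And>x. x \<in> K \<Longrightarrow> \<exists>V\<in>G. ball x e \<subseteq> V"
      using Heine_Borel_lemma[OF K G] by metis
    obtain J \<epsilon> where \<epsilon>: "\<epsilon> > 0"
      "\<forall>x y :: nat \<Rightarrow> complex. (\<forall>i<J. cmod (x i - y i) \<le> \<epsilon>) \<longrightarrow> dist x y < e"
      using dist_fun_less_of_coordinates[OF e(1)] by blast
    obtain A where A: "A \<ge> 1" "\<forall>n. \<exists>Z. finite Z \<and> real (card Z) \<le> A * exp (\<delta> / 2 * real n) \<and>
        (\<forall>m. \<exists>z\<in>Z. \<forall>i<n. cmod (\<eta> (m + i) - \<eta> (z + i)) \<le> \<epsilon>)"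
      using finite_window_centers[OF \<eta>[OF \<epsilon>(1)] half_gt_zero[OF \<delta>]] by (elim exE conjE)
    define M where "M = (\<lambda>n. min_subcover_card Y (cover_refinement Y T U n))"
    have M_le: "real (M n) \<le> A * exp (\<delta> / 2 * real (n + J))" for n
    proof -
      obtain Z where Z: "finite Z" "real (card Z) \<le> A * exp (\<delta> / 2 * real (n + J))"
        "\<And>m. \<exists>z\<in>Z. \<forall>i<n + J. cmod (\<eta> (m + i) - \<eta> (z + i)) \<le> \<epsilon>"
        using A(2)[rule_format, of "n + J"] by (elim exE conjE) (rule that, blast+)
      \<comment> \<open>These sets are closed, so a finite union of them that contains the orbit
        also contains \<open>K\<close>.\<close>
      define near where "near = (\<lambda>z. {y. \<forall>i<n + J. cmod (y i - \<eta> (z + i)) \<le> \<epsilon>})"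
      have "closed (near z)" for z
      proof -
        have "near z = (\<Inter>i\<in>{..<n + J}. (\<lambda>y :: nat \<Rightarrow> complex. y i) -` cball (\<eta> (z + i)) \<epsilon>)"
          by (auto simp: near_def dist_norm norm_minus_commute)
        moreover have "closed ((\<lambda>y :: nat \<Rightarrow> complex. y i) -` cball (\<eta> (z + i)) \<epsilon>)" for i
          by (intro closed_vimage continuous_on_product_coordinates) simp
        ultimately show ?thesis by (simp add: closed_INT)
      qed
      then have "closed (\<Union>z\<in>Z. near z)" using Z(1) by (intro closed_UN) auto
      moreover have "range orb \<subseteq> (\<Union>z\<in>Z. near z)"
        using Z(3) unfolding near_def orb_def by auto
      ultimately have K_sub: "K \<subseteq> (\<Union>z\<in>Z. near z)"
        unfolding K_def by (intro closure_minimal)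
      have "\<exists>C\<in>cover_refinement Y T U n. K \<inter> near z \<subseteq> C" for z
      proof -
        have "\<exists>V. V \<in> G \<and> ball (orb (z + i)) e \<subseteq> V" for i
          using e(2)[OF orb_K] by blast
        then obtain V where V: "\<And>i. V i \<in> G" "\<And>i. ball (orb (z + i)) e \<subseteq> V i" by metis
        \<comment> \<open>The first \<open>J\<close> coordinates of the \<open>i\<close>-th shift
          are entries of \<open>y\<close> before position \<open>i + J\<close>; this is why the
          windows have length \<open>n + J\<close>.\<close>
        have "(T ^^ i) y \<in> K \<inter> V i" if "y \<in> K" "y \<in> near z" "i < n" for i y
        proof -
          have "dist (orb (z + i)) ((T ^^ i) y) < e"
          proof (rule \<epsilon>(2)[rule_format])
            fix j assume "j < J"
            then have "cmod (y (i + j) - \<eta> (z + (i + j))) \<le> \<epsilon>"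
              using that(2,3) unfolding near_def by auto
            then show "cmod (orb (z + i) j - (T ^^ i) y j) \<le> \<epsilon>"
              by (simp add: funpow_T orb_def add.assoc norm_minus_commute)
          qed
          then have "(T ^^ i) y \<in> V i" using V(2)[of i] by auto
          moreover have "(T ^^ i) y \<in> K"
            using funpow_in_topspace[OF T, of y i] that(1) topY by simp
          ultimately show ?thesis by simp
        qed
        then have "K \<inter> near z \<subseteq> {y \<in> topspace Y. \<forall>i<n. (T ^^ i) y \<in> K \<inter> V i}"
          unfolding topY by auto
        moreover have "{y \<in> topspace Y. \<forall>i<n. (T ^^ i) y \<in> K \<inter> V i} \<in> cover_refinement Y T U n"
          unfolding cover_refinement_def
        proof (intro CollectI exI[of _ "\<lambda>i. K \<inter> V i"] conjI refl allI impI)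
          show "K \<inter> V i \<in> U" for i using V(1)[of i] by (simp add: G_def)
        qed
        ultimately show ?thesis by blast
      qed
      then have "\<exists>C. \<forall>z. C z \<in> cover_refinement Y T U n \<and> K \<inter> near z \<subseteq> C z"
        by (intro choice allI) blast
      then obtain C where C: "\<And>z. C z \<in> cover_refinement Y T U n" "\<And>z. K \<inter> near z \<subseteq> C z"
        by blast
      have "C z \<subseteq> K" for z
        using C(1)[of z] unfolding cover_refinement_def topY by auto
      then have "\<Union>(C ` Z) = topspace Y"
        unfolding topY using K_sub C(2) by blast
      then have "M n \<le> card (C ` Z)"
        unfolding M_def using C(1) Z(1) by (intro min_subcover_card_le) auto
      also have "\<dots> \<le> card Z" by (rule card_image_le[OF Z(1)])
      finally show ?thesis using Z(2) by linarith
    qed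
    have M_pos: "M n > 0" for n
      unfolding M_def using orb_K topY by (intro min_subcover_card_pos compY open_cover_refinement[OF T U]) auto
    \<comment> \<open>From this point on \<open>ln A\<close> and the surplus length \<open>J\<close>
      take at most half of \<open>\<delta> * n\<close>; the count with rate \<delta>/2 takes the
      other half.\<close>
    have "\<forall>\<^sub>F n in sequentially. (2 / \<delta>) * (ln A + \<delta> / 2 * real J) \<le> real n"
      by (rule eventually_nat_real[OF eventually_ge_at_top])
    then have "\<forall>\<^sub>F n in sequentially. ereal (ln (real (M n)) / real n) \<le> ereal \<delta>"
      using eventually_gt_at_top[of 0]
    proof eventually_elim
      case (elim n)
      have "ln (real (M n)) \<le> ln (A * exp (\<delta> / 2 * real (n + J)))"
        using M_pos M_le A(1) by (intro ln_mono) auto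
      also have "\<dots> = ln A + \<delta> / 2 * real (n + J)"
        using A(1) by (simp add: ln_mult)
      also have "\<dots> \<le> \<delta> * real n"
        using elim \<delta> by (simp add: field_simps)
      finally show ?case using elim(2) by (simp add: field_simps)
    qed
    then have "limsup (\<lambda>n. ereal (ln (real (M n)) / real n)) \<le> ereal \<delta>"
      by (rule Limsup_bounded)
    then show "cover_entropy Y T U \<le> 0 + ereal \<delta>"
      unfolding cover_entropy_def M_def by simp
  qed
  then have "topological_entropy Y T \<le> 0"
    unfolding topological_entropy_def by (intro SUP_least) simp
  then have "topological_entropy Y T = 0"
    using topological_entropy_nonneg[of Y T] by (rule antisym)
  moreover have "Hausdorff_space Y"
    unfolding Y_def by (intro Hausdorff_space_subtopology) simp
  moreover have "continuous_map Y euclidean (\<lambda>y. y 0)"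
    unfolding Y_def by (auto intro: continuous_on_subset[OF continuous_on_product_coordinates])
  moreover have "\<eta> n = (T ^^ n) (orb 0) 0" for n
    by (simp add: funpow_T orb_def)
  moreover have "orb 0 \<in> topspace Y" using orb_K topY by simp
  ultimately have "deterministic_on Y \<eta>"
    unfolding deterministic_on_def using compY T by blast
  then show ?thesis unfolding deterministic_def by blast
qed

section \<open>Pasting blocks\<close>

text \<open>These are the sequences to be pasted onto the blocks, with one constant per block. There
  may be infinitely many constants, but up to distance \<open>1 / L\<close> they fall into
  polynomially many classes.\<close>

lemma subexponential_twist:
  fixes f :: "'i \<Rightarrow> nat \<Rightarrow> real" and c :: "'i \<Rightarrow> complex"
  assumes f: "poly_close f" and \<xi>: "deterministic \<xi>" and c: "\<And>b. cmod (c b) \<le> 1" and "\<epsilon> > 0"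
  shows "subexponential (close (\<lambda>b n. c b * \<xi> n * e2pi (f b n)) (\<lambda>_. \<epsilon>))"
proof -
  obtain B where B: "B \<ge> 1" "\<And>n. cmod (\<xi> n) \<le> B" using deterministic_bounded[OF \<xi>] by blast
  have "subexponential (close (\<lambda>b n. e2pi (f b n)) (\<lambda>L. 1 / real L ^ 1))"
    using f unfolding poly_close_def by blast
  moreover have "subexponential (\<lambda>L a m b n. cmod (c a - c b) \<le> 1 / real L ^ 1)"
    using subexponential_point[of "\<lambda>b _. c b" 1] c by simp
  moreover have "subexponential (close (\<lambda>_ :: 'i. \<xi>) (\<lambda>_. \<epsilon> / 2))"
    by (rule deterministic_imp_subexponential[OF \<xi> half_gt_zero[OF \<open>\<epsilon> > 0\<close>]])
  ultimately have "subexponential (\<lambda>L a m b n. close (\<lambda>b n. e2pi (f b n)) (\<lambda>L. 1 / real L ^ 1) L a m b n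
      \<and> cmod (c a - c b) \<le> 1 / real L ^ 1 \<and> close (\<lambda>_ :: 'i. \<xi>) (\<lambda>_. \<epsilon> / 2) L a m b n)"
    by (intro subexponential_conj)
  then show ?thesis
  proof (rule subexponential_weaken,
      intro eventually_mono[OF eventually_nat_real[OF eventually_gt_at_top[of "4 * B / \<epsilon>"]]]
        exI[of _ 0] allI impI)
    fix L a m b n
    assume L: "4 * B / \<epsilon> < real L"
      and H: "close (\<lambda>b n. e2pi (f b n)) (\<lambda>L. 1 / real L ^ 1) L a m b n
        \<and> cmod (c a - c b) \<le> 1 / real L ^ 1 \<and> close (\<lambda>_ :: 'i. \<xi>) (\<lambda>_. \<epsilon> / 2) L a m b n"
    have "0 < 4 * B / \<epsilon>" using B(1) \<open>\<epsilon> > 0\<close> by simp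
    then have "0 < real L" using L by linarith
    \<comment> \<open>Origin of the bound \<open>4 * B / \<epsilon>\<close>: the phase error
      \<open>2 / L\<close> times \<open>B\<close> takes half of \<epsilon>, the windows of \<xi>
      take the other half.\<close>
    then have L': "2 / real L * B \<le> \<epsilon> / 2" using L \<open>\<epsilon> > 0\<close> by (simp add: field_simps)
    show "close (\<lambda>b n. c b * \<xi> n * e2pi (f b n)) (\<lambda>_. \<epsilon>) L a m b n"
      unfolding close_def
    proof (intro allI impI)
      fix i assume i: "i < L"
      define u where "u = c a * e2pi (f a (m + i))"
      define u' where "u' = c b * e2pi (f b (n + i))"
      have "cmod (u - u') \<le> cmod (e2pi (f a (m + i)) - e2pi (f b (n + i))) + cmod (c a - c b)"
        unfolding u_def u'_def using c by (intro norm_mult_diff_le) simp_all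
      also have "\<dots> \<le> 1 / real L + 1 / real L"
        using H i unfolding close_def by (intro add_mono) simp_all
      finally have uu: "cmod (u - u') \<le> 2 / real L" by simp
      have "c a * \<xi> (m + i) * e2pi (f a (m + i)) - c b * \<xi> (n + i) * e2pi (f b (n + i))
          = u * (\<xi> (m + i) - \<xi> (n + i)) + (u - u') * \<xi> (n + i)"
        unfolding u_def u'_def by (simp add: algebra_simps)
      then have "cmod (c a * \<xi> (m + i) * e2pi (f a (m + i)) - c b * \<xi> (n + i) * e2pi (f b (n + i)))
          \<le> cmod u * cmod (\<xi> (m + i) - \<xi> (n + i)) + cmod (u - u') * cmod (\<xi> (n + i))"
        by (metis norm_triangle_ineq norm_mult)
      also have "\<dots> \<le> 1 * (\<epsilon> / 2) + 2 / real L * B"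
        using H i uu c B unfolding close_def
        by (intro add_mono mult_mono) (simp_all add: u_def norm_mult)
      also have "\<dots> \<le> \<epsilon>" using L' by simp
      finally show "cmod (c a * \<xi> (m + i) * e2pi (f a (m + i)) - c b * \<xi> (n + i) * e2pi (f b (n + i))) \<le> \<epsilon>" .
    qed
  qed
qed

lemma down_closed_eq_initial_segment:
  assumes "\<And>i j. i < j \<Longrightarrow> j < L \<Longrightarrow> Q j \<Longrightarrow> Q i"
  shows "\<exists>t\<le>L. \<forall>i<L. Q i \<longleftrightarrow> i < (t :: nat)"
  using assms
proof (induction L)
  case (Suc L)
  then obtain t where t: "t \<le> L" "\<forall>i<L. Q i \<longleftrightarrow> i < t"
    by (metis less_SucI)
  show ?case
  proof (cases "Q L")
    case True
    then show ?thesis using Suc.prems by (intro exI[of _ "Suc L"]) (auto simp: less_Suc_eq)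
  next
    case False
    then show ?thesis using t by (intro exI[of _ t]) (auto simp: less_Suc_eq)
  qed
qed simp

text \<open>Blocks are carried as the fibres of \<open>\<iota>\<close>; hypothesis \<open>long\<close> says that far out no block lies
  strictly inside a window of length \<open>L\<close>. Such a window then consists of a final segment of a block,
  a gap, and an initial segment of a block.\<close>

lemma subexponential_concat:
  fixes \<theta> :: "'i \<Rightarrow> nat \<Rightarrow> complex" and \<iota> :: "nat \<Rightarrow> 'i option"
  assumes \<theta>: "subexponential (close \<theta> (\<lambda>_. \<epsilon>))" and "\<epsilon> \<ge> 0"
    and convex: "\<And>b m n k. \<iota> m = Some b \<Longrightarrow> \<iota> n = Some b \<Longrightarrow> m \<le> k \<Longrightarrow> k \<le> n \<Longrightarrow> \<iota> k = Some b"
    and long: "\<And>L. \<exists>N. \<forall>m\<ge>N. \<forall>n b. m \<le> n \<longrightarrow> n \<le> m + L \<longrightarrow> \<iota> n = Some b \<longrightarrow>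
      \<iota> m = Some b \<or> \<iota> (m + L) = Some b"
  shows "subexponential (close (\<lambda>_ :: 'c. \<lambda>n. case \<iota> n of None \<Rightarrow> 0 | Some b \<Rightarrow> \<theta> b n) (\<lambda>_. \<epsilon>))"
  unfolding subexponential_def
proof (intro allI impI)
  fix \<delta> :: real assume \<delta>: "\<delta> > 0"
  define \<eta> where "\<eta> = (\<lambda>n. case \<iota> n of None \<Rightarrow> 0 | Some b \<Rightarrow> \<theta> b n)"
  have "\<forall>\<^sub>F L in sequentially. partitioned (close \<theta> (\<lambda>_. \<epsilon>) L) (exp (\<delta> / 4 * real L))"
    using \<theta> \<delta> unfolding subexponential_def by (meson divide_pos_pos zero_less_numeral)
  moreover have "\<forall>\<^sub>F L in sequentially. (5 * real L ^ 1) ^ 2 \<le> exp (\<delta> / 2 * real L)"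
    using \<delta> by (intro eventually_poly_le_exp) simp
  ultimately show "\<forall>\<^sub>F L in sequentially. partitioned (close (\<lambda>_ :: 'c. \<eta>) (\<lambda>_. \<epsilon>) L) (exp (\<delta> * real L))"
    using eventually_gt_at_top[of 0]
  proof eventually_elim
    case (elim L)
    obtain N C \<kappa> where C: "finite (C :: nat set)" "real (card C) \<le> exp (\<delta> / 4 * real L)"
      "\<And>a n. n \<ge> N \<Longrightarrow> \<kappa> a n \<in> C"
      "\<And>a b m n. m \<ge> N \<Longrightarrow> n \<ge> N \<Longrightarrow> \<kappa> a m = \<kappa> b n \<Longrightarrow> close \<theta> (\<lambda>_. \<epsilon>) L a m b n"
      using elim(1) unfolding partitioned_def by metis
    obtain N' where N': "\<And>m n b. m \<ge> N' \<Longrightarrow> m \<le> n \<Longrightarrow> n \<le> m + L \<Longrightarrow> \<iota> n = Some b \<Longrightarrow>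
        \<iota> m = Some b \<or> \<iota> (m + L) = Some b"
      using long[of L] by blast
    have "\<exists>t t' u v. t \<le> L \<and> t' \<le> L \<and>
        (\<forall>i<L. \<eta> (n + i) = (if i < t then \<theta> u (n + i) else if i < t' then 0 else \<theta> v (n + i)))"
      if n: "n \<ge> N'" for n
    proof -
      \<comment> \<open>\<open>Q i\<close>: position \<open>i\<close> lies in the block of the start
        \<open>n\<close>. \<open>Q' i\<close>: it does not lie in the block of \<open>n + L\<close>,
        the position just after the window. Blocks being intervals, both hold on initial segments of
        the window, which yields the cuts \<open>t\<close> and \<open>t'\<close>.\<close>
      define Q where "Q = (\<lambda>i. \<iota> n \<noteq> None \<and> \<iota> (n + i) = \<iota> n)"
      define Q' where "Q' = (\<lambda>i. \<not> (\<iota> (n + L) \<noteq> None \<and> \<iota> (n + i) = \<iota> (n + L)))"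
      have "Q i" if "i < j" "Q j" for i j
        using convex[of n "the (\<iota> n)" "n + j" "n + i"] that unfolding Q_def by auto
      then obtain t where t: "t \<le> L" "\<forall>i<L. Q i \<longleftrightarrow> i < t"
        using down_closed_eq_initial_segment[of L Q] by blast
      have "Q' i" if "i < j" "j < L" "Q' j" for i j
        using convex[of "n + i" "the (\<iota> (n + L))" "n + L" "n + j"] that unfolding Q'_def by auto
      then obtain t' where t': "t' \<le> L" "\<forall>i<L. Q' i \<longleftrightarrow> i < t'"
        using down_closed_eq_initial_segment[of L Q'] by blast
      have "\<eta> (n + i) = (if i < t then \<theta> (the (\<iota> n)) (n + i) else if i < t' then 0
          else \<theta> (the (\<iota> (n + L))) (n + i))" if i: "i < L" for i
      proof (cases "\<iota> (n + i)")
        case None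
        then have "\<not> i < t" "i < t'" using t(2) t'(2) i unfolding Q_def Q'_def by metis+
        then show ?thesis using None unfolding \<eta>_def by simp
      next
        case (Some b)
        then have "\<iota> n = Some b \<or> \<iota> (n + L) = Some b" using N'[OF n, of "n + i" b] i by simp
        then show ?thesis
          using Some t(2) t'(2) i unfolding \<eta>_def Q_def Q'_def by (auto split: option.splits)
      qed
      then show ?thesis using t(1) t'(1) by blast
    qed
    then obtain t t' u v where piece: "\<And>n. n \<ge> N' \<Longrightarrow> t n \<le> L" "\<And>n. n \<ge> N' \<Longrightarrow> t' n \<le> L"
      "\<And>n i. n \<ge> N' \<Longrightarrow> i < L \<Longrightarrow> \<eta> (n + i) =
        (if i < t n then \<theta> (u n) (n + i) else if i < t' n then 0 else \<theta> (v n) (n + i))"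
      by metis
    \<comment> \<open>The label records two cuts and the classes of two full windows, but not the
      blocks \<open>u n\<close> and \<open>v n\<close>, whose number is unbounded: the classes of
      \<theta> already compare different blocks. The cuts use the rate \<delta>/2, the two classes
      \<delta>/4 each.\<close>
    show ?case
    proof (rule partitionedI[where C = "{..L} \<times> {..L} \<times> C \<times> C" and N = "max N N'"
          and \<kappa> = "\<lambda>_ n. (t n, t' n, \<kappa> (u n) n, \<kappa> (v n) n)"])
      have "real (card ({..L} \<times> {..L} \<times> C \<times> C)) = (real L + 1) ^ 2 * real (card C) ^ 2"
        by (simp add: card_cartesian_product power2_eq_square algebra_simps)
      also have "\<dots> \<le> (5 * real L) ^ 2 * exp (\<delta> / 4 * real L) ^ 2"
        using elim(3) C(2) by (intro mult_mono power_mono) auto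
      also have "\<dots> \<le> exp (\<delta> / 2 * real L) * exp (\<delta> / 4 * real L) ^ 2"
        using elim(2) by (intro mult_right_mono) auto
      also have "\<dots> = exp (\<delta> * real L)"
        by (simp add: power2_eq_square flip: exp_add)
      finally show "real (card ({..L} \<times> {..L} \<times> C \<times> C)) \<le> exp (\<delta> * real L)" .
    next
      fix a b :: 'c and m n
      assume mn: "max N N' \<le> m" "max N N' \<le> n"
        and eq: "(t m, t' m, \<kappa> (u m) m, \<kappa> (v m) m) = (t n, t' n, \<kappa> (u n) n, \<kappa> (v n) n)"
      have "close \<theta> (\<lambda>_. \<epsilon>) L (u m) m (u n) n" "close \<theta> (\<lambda>_. \<epsilon>) L (v m) m (v n) n"
        using mn eq by (auto intro: C(4))
      then show "close (\<lambda>_ :: 'c. \<eta>) (\<lambda>_. \<epsilon>) L a m b n"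
        using mn eq piece(3) \<open>\<epsilon> \<ge> 0\<close> unfolding close_def by simp
    qed (use C(1,3) piece(1,2) in auto)
  qed
qed

lemma sum_consecutive_blocks:
  fixes a :: "nat \<Rightarrow> nat" and h :: "nat \<Rightarrow> 'a :: comm_monoid_add"
  assumes "\<And>t. t < T \<Longrightarrow> a t \<le> a (Suc t)"
  shows "a 0 \<le> a T \<and> (\<Sum>t<T. \<Sum>n\<in>{a t..<a (Suc t)}. h n) = (\<Sum>n\<in>{a 0..<a T}. h n)"
  using assms
proof (induction T)
  case (Suc T)
  then have IH: "a 0 \<le> a T" "(\<Sum>t<T. \<Sum>n\<in>{a t..<a (Suc t)}. h n) = (\<Sum>n\<in>{a 0..<a T}. h n)"
    by simp_all
  moreover have "a T \<le> a (Suc T)" using Suc.prems by simp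
  ultimately show ?case
    using sum.atLeastLessThan_concat[of "a 0" "a T" "a (Suc T)" h] by auto
qed simp

section \<open>Block sums\<close>

text \<open>A difference of two prefix sums, each at most \<delta>/2 times its end point; the bound
  is therefore relative to \<open>b\<close> and not to \<open>b - a\<close>.\<close>

lemma sarnak_interval_sum:
  assumes "sarnak_conjecture" "deterministic \<eta>" "\<delta> > 0"
  obtains N where "\<And>a b. N \<le> a \<Longrightarrow> a \<le> b \<Longrightarrow>
    cmod (\<Sum>n\<in>{a..<b}. of_int (moebius_mu n) * \<eta> n) \<le> \<delta> * real b"
proof -
  define h where "h = (\<lambda>n. of_int (moebius_mu n) * \<eta> n)"
  have "(\<lambda>N. (\<Sum>n=1..N. h n) / of_nat N) \<longlonglongrightarrow> 0"
    using assms(1,2) unfolding sarnak_conjecture_def h_def by blast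
  from tendstoD[OF this half_gt_zero[OF assms(3)]]
  obtain N where N: "\<And>n. n \<ge> N \<Longrightarrow> cmod ((\<Sum>n=1..n. h n) / of_nat n) < \<delta> / 2"
    unfolding eventually_sequentially by (auto simp: dist_norm)
  \<comment> \<open>\<open>{1..<b}\<close> ends at \<open>b - 1\<close>, which has to be positive
    and at least \<open>N\<close>.\<close>
  have S: "cmod (\<Sum>n\<in>{1..<b}. h n) \<le> \<delta> / 2 * real b" if b: "b \<ge> Suc (Suc N)" for b
  proof -
    obtain m where m: "b = Suc m" "m \<ge> N" "m > 0" using b by (cases b) auto
    have "cmod (\<Sum>n\<in>{1..<b}. h n) \<le> \<delta> / 2 * real m"
      using N[OF m(2)] m(1,3)
      by (simp add: norm_divide field_simps atLeastLessThanSuc_atLeastAtMost)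
    also have "\<dots> \<le> \<delta> / 2 * real b" using m(1) assms(3) by simp
    finally show ?thesis .
  qed
  show thesis
  proof (rule that[of "Suc (Suc N)"])
    fix a b assume ab: "Suc (Suc N) \<le> a" "a \<le> b"
    have "(\<Sum>n\<in>{1..<a}. h n) + (\<Sum>n\<in>{a..<b}. h n) = (\<Sum>n\<in>{1..<b}. h n)"
      using ab by (intro sum.atLeastLessThan_concat) auto
    then have "(\<Sum>n\<in>{a..<b}. h n) = (\<Sum>n\<in>{1..<b}. h n) - (\<Sum>n\<in>{1..<a}. h n)"
      by (simp add: algebra_simps)
    then have "cmod (\<Sum>n\<in>{a..<b}. h n) \<le> \<delta> / 2 * real b + \<delta> / 2 * real a"
      using norm_triangle_ineq4[of "\<Sum>n\<in>{1..<b}. h n" "\<Sum>n\<in>{1..<a}. h n"] S[of a] S[of b] ab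
      by simp
    also have "\<dots> \<le> \<delta> / 2 * real b + \<delta> / 2 * real b"
      using ab assms(3) by (intro add_left_mono mult_left_mono) auto
    finally show "cmod (\<Sum>n\<in>{a..<b}. of_int (moebius_mu n) * \<eta> n) \<le> \<delta> * real b"
      unfolding h_def by simp
  qed
qed

text \<open>One \<open>M\<close> has to serve for every number of blocks and every selection from
  \<open>D\<close>. If none does, each \<open>M\<close> fails on a finite chain of consecutive
  blocks, and such chains are strung together as stages. The families in hypothesis \<open>D\<close>
  are indexed by stage and block.\<close>

lemma block_sums_small:
  fixes D :: "(nat \<Rightarrow> real) set"
  assumes sarnak: "sarnak_conjecture" and \<xi>: "deterministic \<xi>"
    and D: "\<And>f :: nat \<times> nat \<Rightarrow> nat \<Rightarrow> real. (\<And>b. f b \<in> D) \<Longrightarrow> poly_close f"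
    and "\<delta> > 0"
  shows "\<exists>M. \<forall>T a \<phi>. M \<le> a 0 \<longrightarrow> (\<forall>t<T. a t + M \<le> a (Suc t)) \<longrightarrow> (\<forall>t. \<phi> t \<in> D) \<longrightarrow>
    (\<Sum>t<T. cmod (\<Sum>n\<in>{a t..<a (Suc t)}. of_int (moebius_mu n) * \<xi> n * e2pi (\<phi> t n))) \<le> \<delta> * real (a T)"
proof (rule ccontr)
  assume neg: "\<not> ?thesis"
  define s where "s = (\<lambda>(a :: nat \<Rightarrow> nat) \<phi> t.
    \<Sum>n\<in>{a t..<a (Suc t)}. of_int (moebius_mu n) * \<xi> n * e2pi (\<phi> t n))"
  define bad where "bad = (\<lambda>M (T, a, \<phi>). M < a 0 \<and> (\<forall>t<T. a t + M < a (Suc t)) \<and>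
    (\<forall>t. \<phi> t \<in> D) \<and> \<delta> * real (a T) < (\<Sum>t<T. cmod (s a \<phi> t)))"
  have ex_bad: "\<exists>x. bad M x" for M
  proof -
    obtain T a \<phi> where "Suc M \<le> a 0" "\<forall>t<T. a t + Suc M \<le> a (Suc t)" "\<forall>t. \<phi> t \<in> D"
      "\<not> (\<Sum>t<T. cmod (s a \<phi> t)) \<le> \<delta> * real (a T)"
      using neg unfolding s_def by blast
    then show ?thesis unfolding bad_def by (intro exI[of _ "(T, a, \<phi>)"]) (auto simp: less_eq_Suc_le)
  qed
  have "\<exists>x. \<forall>j. bad j (x j) \<and> (case x j of (T, a, \<phi>) \<Rightarrow> case x (Suc j) of (T', a', \<phi>') \<Rightarrow> a T \<le> a' 0)"
  proof (rule dependent_nat_choice)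
    fix x :: "nat \<times> (nat \<Rightarrow> nat) \<times> (nat \<Rightarrow> nat \<Rightarrow> real)" and j
    obtain T a \<phi> where x: "x = (T, a, \<phi>)" by (metis prod_cases3)
    \<comment> \<open>Failure at this maximum makes the new blocks longer than \<open>Suc j\<close>
      and starts the new stage beyond the end \<open>a T\<close> of the old one.\<close>
    obtain y where y: "bad (max (Suc j) (a T)) y" using ex_bad by blast
    then show "\<exists>y. bad (Suc j) y \<and> (case x of (T, a, \<phi>) \<Rightarrow> case y of (T', a', \<phi>') \<Rightarrow> a T \<le> a' 0)"
      unfolding bad_def x by (intro exI[of _ y]) (auto split: prod.splits simp: max_def split: if_splits)
  qed (use ex_bad in blast)
  then obtain x where x: "\<forall>j. bad j (x j) \<and>
      (case x j of (T, a, \<phi>) \<Rightarrow> case x (Suc j) of (T', a', \<phi>') \<Rightarrow> a T \<le> a' 0)" ..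
  define T where "T = (\<lambda>j. fst (x j))"
  define a where "a = (\<lambda>j. fst (snd (x j)))"
  define \<phi> where "\<phi> = (\<lambda>j. snd (snd (x j)))"
  have x_eq: "x j = (T j, a j, \<phi> j)" for j by (simp add: T_def a_def \<phi>_def)
  have a0: "j < a j 0" and gap: "\<And>t. t < T j \<Longrightarrow> a j t + j < a j (Suc t)"
    and \<phi>: "\<And>t. \<phi> j t \<in> D" and big: "\<delta> * real (a j (T j)) < (\<Sum>t<T j. cmod (s (a j) (\<phi> j) t))"
    and next_stage: "a j (T j) \<le> a (Suc j) 0" for j
    using x[rule_format, of j] unfolding bad_def x_eq by auto
  have mono: "a j t \<le> a j t'" if "t \<le> t'" "t' \<le> T j" for j t t'
    using that
  proof (induction t' rule: dec_induct)
    case (step k)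
    then show ?case using gap[of k j] by simp
  qed simp
  have stage: "a i (T i) \<le> a j 0" if "i < j" for i j
    using that
  proof (induction j)
    case (Suc j)
    then show ?case
      using next_stage[of j] mono[of 0 "T j" j] by (cases "i = j") auto
  qed simp
  define blk where "blk = (\<lambda>(j, t) n. t < T j \<and> a j t \<le> n \<and> n < a j (Suc t))"
  have unique: "b = b'" if bb: "blk b n" "blk b' n" for b b' n
  proof -
    obtain j t j' t' where b: "b = (j, t)" "b' = (j', t')" by (metis surj_pair)
    have before: False if "blk (i, u) n" "blk (i', u') n" "i < i' \<or> i = i' \<and> u < u'" for i u i' u'
    proof (cases "i < i'")
      case True
      have "n < a i (T i)" using that(1) mono[of "Suc u" "T i" i] unfolding blk_def by auto
      moreover have "a i' 0 \<le> n" using that(2) mono[of 0 u' i'] unfolding blk_def by auto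
      ultimately show False using stage[OF True] by simp
    next
      case False
      then have "a i (Suc u) \<le> a i u'" using that unfolding blk_def by (intro mono) auto
      then show False using that False unfolding blk_def by auto
    qed
    have "j = j'" using before[of j t j' t'] before[of j' t' j t] bb unfolding b
      by (meson linorder_neqE_nat)
    moreover have "t = t'" using before[of j t j' t'] before[of j' t' j t] bb \<open>j = j'\<close> unfolding b
      by (meson linorder_neqE_nat)
    ultimately show ?thesis using b by simp
  qed
  define \<iota> where "\<iota> = (\<lambda>n. if \<exists>b. blk b n then Some (THE b. blk b n) else None)"
  have \<iota>: "\<iota> n = Some b \<longleftrightarrow> blk b n" for n b
  proof -
    have "(THE b. blk b n) = b" if "blk b n" for b
      using that unique by (intro the_equality) blast+
    then show ?thesis unfolding \<iota>_def by (metis option.distinct(1) option.inject)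
  qed
  \<comment> \<open>Multiplication by the conjugate sign turns the block sum into its modulus. As
    \<open>sgn 0 = 0\<close>, a vanishing block sum gets the constant 0, so only
    \<open>cmod (c b) \<le> 1\<close> is available.\<close>
  define c where "c = (\<lambda>(j, t). cnj (sgn (s (a j) (\<phi> j) t)))"
  define \<theta> where "\<theta> = (\<lambda>b n. c b * \<xi> n * e2pi (\<phi> (fst b) (snd b) n))"
  define \<eta> where "\<eta> = (\<lambda>n. case \<iota> n of None \<Rightarrow> 0 | Some b \<Rightarrow> \<theta> b n)"
  have c: "cmod (c b) \<le> 1" for b by (cases b) (simp add: c_def norm_sgn)
  obtain B where B: "B \<ge> 1" "\<And>n. cmod (\<xi> n) \<le> B" using deterministic_bounded[OF \<xi>] by blast
  have "deterministic \<eta>"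
  proof (rule subexponential_imp_deterministic)
    have "cmod (\<theta> b n) \<le> 1 * B" for b n
      unfolding \<theta>_def norm_mult using mult_mono[OF c[of b] B(2)[of n]] by simp
    then show "cmod (\<eta> n) \<le> B" for n
      using B(1) unfolding \<eta>_def by (simp split: option.splits)
  next
    fix \<epsilon> :: real assume \<epsilon>: "\<epsilon> > 0"
    have "poly_close (\<lambda>b. \<phi> (fst b) (snd b))" by (rule D) (rule \<phi>)
    then have "subexponential (close \<theta> (\<lambda>_. \<epsilon>))"
      unfolding \<theta>_def using \<xi> c \<epsilon> by (rule subexponential_twist)
    then show "subexponential (close (\<lambda>_ :: unit. \<eta>) (\<lambda>_. \<epsilon>))"
      unfolding \<eta>_def
    proof (rule subexponential_concat)
      show "\<iota> k = Some b" if "\<iota> m = Some b" "\<iota> n = Some b" "m \<le> k" "k \<le> n" for b m n k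
        using that unfolding \<iota> blk_def by (auto split: prod.splits)
    next
      fix L
      \<comment> \<open>Beyond the start of stage \<open>L\<close> only blocks of stages
        \<open>j \<ge> L\<close> occur, and these are longer than \<open>L\<close>.\<close>
      show "\<exists>N. \<forall>m\<ge>N. \<forall>n b. m \<le> n \<longrightarrow> n \<le> m + L \<longrightarrow> \<iota> n = Some b \<longrightarrow>
        \<iota> m = Some b \<or> \<iota> (m + L) = Some b"
      proof (intro exI[of _ "a L 0"] allI impI)
        fix m n b assume m: "a L 0 \<le> m" and mn: "m \<le> n" "n \<le> m + L" and b: "\<iota> n = Some b"
        obtain j t where jt: "b = (j, t)" by (cases b)
        have n: "t < T j" "a j t \<le> n" "n < a j (Suc t)"
          using b unfolding \<iota> jt blk_def by auto
        have "L \<le> j"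
        proof (rule ccontr)
          assume "\<not> L \<le> j"
          then have "a j (T j) \<le> a L 0" by (intro stage) simp
          moreover have "a j (Suc t) \<le> a j (T j)" using n(1) by (intro mono) auto
          ultimately show False using n(3) m mn(1) by linarith
        qed
        \<comment> \<open>A block longer than \<open>L\<close> cannot both begin after
          \<open>m\<close> and end by \<open>m + L\<close>.\<close>
        then have "a j t \<le> m \<or> m + L < a j (Suc t)" using gap[OF n(1)] by linarith
        then show "\<iota> m = Some b \<or> \<iota> (m + L) = Some b"
          unfolding \<iota> jt blk_def using n mn by auto
      qed
    qed (use \<epsilon> in simp)
  qed
  then obtain N where N: "\<And>a b. N \<le> a \<Longrightarrow> a \<le> b \<Longrightarrow>
      cmod (\<Sum>n\<in>{a..<b}. of_int (moebius_mu n) * \<eta> n) \<le> \<delta> * real b"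
    using sarnak_interval_sum[OF sarnak _ \<open>\<delta> > 0\<close>] by blast
  \<comment> \<open>Stage \<open>N\<close> starts beyond \<open>N\<close>, so the interval bound
    applies from its first block to its last and contradicts the choice of that stage.\<close>
  define j where "j = N"
  have concat: "a j 0 \<le> a j (T j) \<and> (\<Sum>t<T j. \<Sum>n\<in>{a j t..<a j (Suc t)}. of_int (moebius_mu n) * \<eta> n)
      = (\<Sum>n\<in>{a j 0..<a j (T j)}. of_int (moebius_mu n) * \<eta> n)"
    by (rule sum_consecutive_blocks) (use gap in \<open>meson add_leD1 less_imp_le\<close>)
  have "(\<Sum>n\<in>{a j t..<a j (Suc t)}. of_int (moebius_mu n) * \<eta> n) = of_real (cmod (s (a j) (\<phi> j) t))"
    if t: "t < T j" for t
  proof -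
    have "of_int (moebius_mu n) * \<eta> n = c (j, t) * (of_int (moebius_mu n) * \<xi> n * e2pi (\<phi> j t n))"
      if "n \<in> {a j t..<a j (Suc t)}" for n
    proof -
      have "\<iota> n = Some (j, t)" unfolding \<iota> blk_def using that t by auto
      then show ?thesis by (simp add: \<eta>_def \<theta>_def mult_ac)
    qed
    then have "(\<Sum>n\<in>{a j t..<a j (Suc t)}. of_int (moebius_mu n) * \<eta> n) = c (j, t) * s (a j) (\<phi> j) t"
      unfolding s_def sum_distrib_left by (intro sum.cong) auto
    also have "\<dots> = of_real (cmod (s (a j) (\<phi> j) t))"
    proof (cases "s (a j) (\<phi> j) t = 0")
      case False
      then show ?thesis
        using complex_norm_square[of "s (a j) (\<phi> j) t"]
        by (simp add: c_def sgn_eq field_simps power2_eq_square)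
    qed simp
    finally show ?thesis .
  qed
  then have "(\<Sum>n\<in>{a j 0..<a j (T j)}. of_int (moebius_mu n) * \<eta> n)
      = of_real (\<Sum>t<T j. cmod (s (a j) (\<phi> j) t))"
    using concat by simp
  then have "cmod (\<Sum>n\<in>{a j 0..<a j (T j)}. of_int (moebius_mu n) * \<eta> n)
      = (\<Sum>t<T j. cmod (s (a j) (\<phi> j) t))"
    by (simp only: norm_of_real) (simp add: sum_nonneg)
  then have "(\<Sum>t<T j. cmod (s (a j) (\<phi> j) t)) \<le> \<delta> * real (a j (T j))"
    using N[of "a j 0" "a j (T j)"] a0[of j] concat unfolding j_def by simp
  then show False using big[of j] by simp
qed

section \<open>From block sums to the integral\<close>

text \<open>The supremum in the integrand is taken anew for each block, whereas block sums are
  bounded for one selection \<phi> at a time; no supremum has to be attained. The summand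
  \<open>r\<close> carries the terms already split off through the induction.\<close>

lemma sum_SUP_le_ennreal:
  fixes F :: "nat \<Rightarrow> 'a \<Rightarrow> ennreal"
  assumes "D \<noteq> {}" and "\<And>\<phi>. (\<And>t. \<phi> t \<in> D) \<Longrightarrow> (\<Sum>t<T. F t (\<phi> t)) + r \<le> c"
  shows "(\<Sum>t<T. SUP f\<in>D. F t f) + r \<le> c"
  using assms(2)
proof (induction T arbitrary: r)
  case 0
  obtain d where "d \<in> D" using assms(1) by blast
  with 0[of "\<lambda>_. d"] show ?case by simp
next
  case (Suc T)
  have "(SUP f\<in>D. F T f + ((\<Sum>t<T. SUP f\<in>D. F t f) + r)) \<le> c"
  proof (rule SUP_least)
    fix f assume f: "f \<in> D"
    have "(\<Sum>t<T. SUP f\<in>D. F t f) + (F T f + r) \<le> c"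
    proof (rule Suc.IH)
      fix \<phi> assume \<phi>: "\<And>t :: nat. \<phi> t \<in> D"
      have "(\<Sum>t<Suc T. F t ((\<phi>(T := f)) t)) + r \<le> c"
        using \<phi> f by (intro Suc.prems) simp
      moreover have "(\<Sum>t<T. F t ((\<phi>(T := f)) t)) = (\<Sum>t<T. F t (\<phi> t))"
        by (intro sum.cong) auto
      ultimately show "(\<Sum>t<T. F t (\<phi> t)) + (F T f + r) \<le> c"
        by (simp add: add.assoc)
    qed
    then show "F T f + ((\<Sum>t<T. SUP f\<in>D. F t f) + r) \<le> c" by (simp add: ac_simps)
  qed
  then have "(SUP f\<in>D. F T f) + ((\<Sum>t<T. SUP f\<in>D. F t f) + r) \<le> c"
    by (simp only: ennreal_SUP_add_left[OF assms(1)])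
  then show ?case by (simp add: ac_simps)
qed

text \<open>\<open>D\<close> may be uncountable, so measurability of the supremum cannot come from
  its members. The integers in [x, x + h), however, depend only on two ceilings, and these take
  countably many values.\<close>

lemma measurable_of_ceilings:
  fixes \<Gamma> :: "int \<Rightarrow> int \<Rightarrow> ennreal"
  shows "(\<lambda>x :: real. \<Gamma> \<lceil>x\<rceil> \<lceil>x + h\<rceil>) \<in> borel_measurable borel"
proof -
  have 1: "(\<lambda>x :: real. \<lceil>x\<rceil>) \<in> borel \<rightarrow>\<^sub>M count_space UNIV"
    "(\<lambda>x :: real. \<lceil>x + h\<rceil>) \<in> borel \<rightarrow>\<^sub>M count_space UNIV"
    by measurable
  have "(\<lambda>x :: real. \<Gamma> i \<lceil>x + h\<rceil>) \<in> borel_measurable borel" for i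
    by (rule measurable_compose_countable[OF _ 1(2), of "\<lambda>j _. \<Gamma> i j"]) simp
  then show ?thesis
    by (rule measurable_compose_countable[OF _ 1(1), of "\<lambda>i x. \<Gamma> i \<lceil>x + h\<rceil>"])
qed

text \<open>For fixed \<open>u\<close> the points \<open>X + t * h + u\<close> are spaced by
  \<open>h\<close>, so the windows of length \<open>h\<close> starting at them are consecutive.
  Cutting [X, 2X] into steps of length \<open>h\<close> and moving each step to [0, h) thus reduces
  the integral to sums over chains of blocks.\<close>

lemma nn_integral_split_shift:
  fixes G :: "real \<Rightarrow> ennreal"
  assumes G: "G \<in> borel_measurable borel" and h: "h > 0" and T: "X < real T * h" and c: "c \<ge> 0"
    and bound: "\<And>u. 0 \<le> u \<Longrightarrow> u < h \<Longrightarrow> (\<Sum>t<T. G (X + real t * h + u)) \<le> ennreal c"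
  shows "(\<integral>\<^sup>+x\<in>{X..2 * X}. G x \<partial>lborel) \<le> ennreal (c * h)"
proof -
  define I where "I = (\<lambda>t :: nat. {X + real t * h..<X + real t * h + h})"
  have shift: "(\<lambda>u. G (y + u)) \<in> borel_measurable lborel" for y
    by (rule measurable_compose[OF _ G]) simp
  have "G x * indicator {X..2 * X} x \<le> (\<Sum>t<T. G x * indicator (I t) x)" for x
  proof (cases "x \<in> {X..2 * X}")
    case True
    define t where "t = nat \<lfloor>(x - X) / h\<rfloor>"
    have t: "real t \<le> (x - X) / h" "(x - X) / h < real t + 1"
      using True h unfolding t_def by (auto simp: of_nat_nat)
    have "(x - X) / h < real T" using True T h by (simp add: field_simps)
    then have "t < T" using t(1) by linarith
    moreover have "x \<in> I t" using t h unfolding I_def by (simp add: field_simps)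
    ultimately show ?thesis
      using True member_le_sum[of t "{..<T}" "\<lambda>t. G x * indicator (I t) x"] by simp
  qed simp
  then have "(\<integral>\<^sup>+x\<in>{X..2 * X}. G x \<partial>lborel) \<le> (\<integral>\<^sup>+x. (\<Sum>t<T. G x * indicator (I t) x) \<partial>lborel)"
    by (intro nn_integral_mono) simp
  also have "\<dots> = (\<Sum>t<T. \<integral>\<^sup>+x. G x * indicator (I t) x \<partial>lborel)"
    using G unfolding I_def
    by (intro nn_integral_sum borel_measurable_times borel_measurable_indicator) simp_all
  also have "\<dots> = (\<Sum>t<T. \<integral>\<^sup>+u. G (X + real t * h + u) * indicator {0..<h} u \<partial>lborel)"
  proof (intro sum.cong refl)
    fix t
    have "(\<integral>\<^sup>+x. G x * indicator (I t) x \<partial>lborel)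
        = (\<integral>\<^sup>+u. G (X + real t * h + u) * indicator (I t) (X + real t * h + u) \<partial>lborel)"
      using G nn_integral_real_affine[of "\<lambda>x. G x * indicator (I t) x" 1 "X + real t * h"]
      unfolding I_def by simp
    also have "\<dots> = (\<integral>\<^sup>+u. G (X + real t * h + u) * indicator {0..<h} u \<partial>lborel)"
      unfolding I_def by (intro nn_integral_cong) (simp add: indicator_def)
    finally show "(\<integral>\<^sup>+x. G x * indicator (I t) x \<partial>lborel) = \<dots>" .
  qed
  also have "\<dots> = (\<integral>\<^sup>+u. (\<Sum>t<T. G (X + real t * h + u) * indicator {0..<h} u) \<partial>lborel)"
    using shift by (intro nn_integral_sum[symmetric] borel_measurable_times borel_measurable_indicator) simp_all
  also have "\<dots> \<le> (\<integral>\<^sup>+u. ennreal c * indicator {0..<h} u \<partial>lborel)"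
    using bound by (intro nn_integral_mono) (auto simp: indicator_def)
  also have "\<dots> = ennreal (c * h)"
    using h c by (simp add: nn_integral_cmult_indicator ennreal_mult)
  finally show ?thesis .
qed

lemma tendsto_zero_ennrealI:
  fixes f :: "'a \<Rightarrow> ennreal"
  assumes "\<And>r :: real. r > 0 \<Longrightarrow> \<forall>\<^sub>F x in F. f x \<le> ennreal r"
  shows "(f \<longlongrightarrow> 0) F"
proof (rule order_tendstoI)
  fix a :: ennreal assume "0 < a"
  then obtain z where z: "0 < z" "z < a" using dense by blast
  then have "z = ennreal (enn2real z)" "enn2real z > 0"
    by (auto simp: enn2real_positive_iff dest: order.strict_trans2[OF _ top_greatest])
  with assms[of "enn2real z"] have "\<forall>\<^sub>F x in F. f x \<le> z" by simp
  then show "\<forall>\<^sub>F x in F. f x < a" by eventually_elim (use z in auto)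
qed simp

theorem theorem3p2:
  fixes w k :: nat
    and p :: "nat \<Rightarrow> real poly"
    and S :: "nat \<Rightarrow> nat set"
    and g :: "nat \<Rightarrow> real"
    and D :: "(nat \<Rightarrow> real) set"
    and \<xi> :: "nat \<Rightarrow> complex"
  assumes "w \<ge> 1"
    and "(\<Union>v\<in>{1..w}. S v) = UNIV"
    and "disjoint_family_on S {1..w}"
    and "\<And>v. v \<in> {1..w} \<Longrightarrow> deterministic (indicator (S v))"
    and "\<And>n. g n = (\<Sum>v=1..w. indicator (S v) n * poly (p v) (real n))"
    and "k \<ge> 1"
    and "(\<lambda>n. SUP f\<in>D. ennreal (dist_nearest_int ((forward_diff ^^ k) f n - g n)))
           \<longlonglongrightarrow> 0"
    and "sarnak_conjecture"
    and "deterministic \<xi>"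
  shows "((\<lambda>h::real. Limsup at_top (\<lambda>X::real.
            (\<integral>\<^sup>+x\<in>{X..2*X}. (SUP f\<in>D.
                ennreal (cmod (\<Sum>n | x \<le> real n \<and> real n < x + h.
                  of_int (moebius_mu n) * \<xi> n * e2pi (f n)))) \<partial>lborel)
            / ennreal (X * h)))
          \<longlongrightarrow> 0) at_top"
proof (rule tendsto_zero_ennrealI)
  fix r :: real assume r: "r > 0"
  \<comment> \<open>Few windows pass from the polynomials and indicators to \<open>g\<close>, from
    \<open>g\<close> to the \<open>k\<close>-th differences, and by integration to any family chosen
    from \<open>D\<close>.\<close>
  have "poly_close f" if f: "\<And>b. f b \<in> D" for f :: "nat \<times> nat \<Rightarrow> nat \<Rightarrow> real"
  proof -
    have "poly_close (\<lambda>_ :: nat \<times> nat. \<lambda>n. \<Sum>v=1..w. indicator (S v) n * poly (p v) (real n))"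
      using assms(4)
      by (intro poly_close_sum poly_close_indicator_mult poly_close_poly deterministic_imp_subexponential) auto
    moreover have "g = (\<lambda>n. \<Sum>v=1..w. indicator (S v) n * poly (p v) (real n))"
      by (rule ext) (rule assms(5))
    ultimately have "poly_close (\<lambda>_ :: nat \<times> nat. g)" by (simp only:)
    then have "poly_close (\<lambda>b. (forward_diff ^^ k) (f b))"
    proof (rule poly_close_asymptotic)
      fix r :: real assume "r > 0"
      then have "\<forall>\<^sub>F n in sequentially.
          (SUP f\<in>D. ennreal (dist_nearest_int ((forward_diff ^^ k) f n - g n))) < ennreal r"
        using assms(7) by (intro order_tendstoD) auto
      then show "\<forall>\<^sub>F n in sequentially. \<forall>b. dist_nearest_int ((forward_diff ^^ k) (f b) n - g n) < r"
      proof eventually_elim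
        case (elim n)
        have "ennreal (dist_nearest_int ((forward_diff ^^ k) (f b) n - g n)) < ennreal r" for b
          by (rule le_less_trans[OF SUP_upper elim]) (rule f)
        then show ?case by (simp add: ennreal_less_iff dist_nearest_int_def infdist_nonneg)
      qed
    qed
    then show ?thesis by (rule poly_close_of_forward_diff_iterate)
  qed
  \<comment> \<open>The last block will end before \<open>X + u + T * h + 1 \<le> 5 * X\<close>,
    whence the divisor 5.\<close>
  moreover have "r / 5 > 0" using r by simp
  ultimately obtain M where M: "\<And>T a \<phi>. M \<le> a 0 \<Longrightarrow> (\<And>t. t < T \<Longrightarrow> a t + M \<le> a (Suc t)) \<Longrightarrow> (\<And>t. \<phi> t \<in> D) \<Longrightarrow>
    (\<Sum>t<T. cmod (\<Sum>n\<in>{a t..<a (Suc t)}. of_int (moebius_mu n) * \<xi> n * e2pi (\<phi> t n))) \<le> r / 5 * real (a T)"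
    using block_sums_small[OF assms(8,9), of D "r / 5"] by blast
  define G where "G = (\<lambda>h x :: real. SUP f\<in>D. ennreal (cmod (\<Sum>n | x \<le> real n \<and> real n < x + h.
                  of_int (moebius_mu n) * \<xi> n * e2pi (f n))))"
  have G_meas: "G h \<in> borel_measurable borel" for h
  proof -
    have "G h = (\<lambda>x. SUP f\<in>D. ennreal (cmod (\<Sum>n | \<lceil>x\<rceil> \<le> int n \<and> int n < \<lceil>x + h\<rceil>.
                  of_int (moebius_mu n) * \<xi> n * e2pi (f n))))"
      unfolding G_def by (simp add: ceiling_le_iff less_ceiling_iff)
    then show ?thesis
      using measurable_of_ceilings[of "\<lambda>i j. SUP f\<in>D. ennreal (cmod (\<Sum>n | i \<le> int n \<and> int n < j.
                  of_int (moebius_mu n) * \<xi> n * e2pi (f n)))" h] by simp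
  qed
  have G_sum: "(\<Sum>t<T. G h (X + real t * h + u)) \<le> ennreal (r / 5 * (X + u + real T * h + 1))"
    if h: "h \<ge> real M + 1" and X: "X \<ge> real M" "X \<ge> 0" and u: "u \<ge> 0" for h X u T
  proof (cases "D = {}")
    case False
    \<comment> \<open>Rounding up the end points of the real windows gives integer blocks that
      adjoin each other.\<close>
    define a where "a = (\<lambda>t. nat \<lceil>X + u + real t * h\<rceil>)"
    have nonneg: "0 \<le> X + u + real t * h" for t using X u h by simp
    have block: "{n. X + real t * h + u \<le> real n \<and> real n < X + real t * h + u + h} = {a t..<a (Suc t)}" for t
    proof -
      have "X + real t * h + u + h = X + u + real (Suc t) * h" by (simp add: algebra_simps)
      then show ?thesis
        using nonneg[of t] nonneg[of "Suc t"] unfolding a_def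
        by (auto simp: nat_le_iff ceiling_le_iff zless_nat_eq_int_zless less_ceiling_iff algebra_simps)
    qed
    have a_real: "X + u + real t * h \<le> real (a t)" "real (a t) < X + u + real t * h + 1" for t
      using nonneg[of t] unfolding a_def by (simp_all add: of_nat_nat) linarith+
    have "(\<Sum>t<T. G h (X + real t * h + u)) + 0 \<le> ennreal (r / 5 * (X + u + real T * h + 1))"
      unfolding G_def block
    proof (rule sum_SUP_le_ennreal[OF False])
      fix \<phi> :: "nat \<Rightarrow> nat \<Rightarrow> real" assume \<phi>: "\<And>t. \<phi> t \<in> D"
      have "(\<Sum>t<T. cmod (\<Sum>n\<in>{a t..<a (Suc t)}. of_int (moebius_mu n) * \<xi> n * e2pi (\<phi> t n))) \<le> r / 5 * real (a T)"
      proof (rule M[OF _ _ \<phi>])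
        show "M \<le> a 0" using a_real(1)[of 0] X u by simp
        \<comment> \<open>Rounding shortens a block by less than 1; hence the requirement
          \<open>h \<ge> M + 1\<close>.\<close>
        show "a t + M \<le> a (Suc t)" for t
        proof -
          have "real (a t) + real M < X + u + real t * h + h"
            using a_real(2)[of t] h by linarith
          also have "\<dots> \<le> real (a (Suc t))" using a_real(1)[of "Suc t"] by (simp add: algebra_simps)
          finally show ?thesis by linarith
        qed
      qed
      also have "\<dots> \<le> r / 5 * (X + u + real T * h + 1)"
        using a_real(2)[of T] r by (intro mult_left_mono) auto
      finally show "(\<Sum>t<T. ennreal (cmod (\<Sum>n\<in>{a t..<a (Suc t)}. of_int (moebius_mu n) * \<xi> n * e2pi (\<phi> t n)))) + 0
          \<le> ennreal (r / 5 * (X + u + real T * h + 1))"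
        by (simp add: ennreal_leI)
    qed
    then show ?thesis by simp
  qed (simp add: G_def bot_ennreal)
  have "Limsup at_top (\<lambda>X. (\<integral>\<^sup>+x\<in>{X..2 * X}. G h x \<partial>lborel) / ennreal (X * h)) \<le> ennreal r"
    if h: "h \<ge> real M + 1" for h
  proof (rule Limsup_bounded)
    have "h > 0" using h by linarith
    show "\<forall>\<^sub>F X in at_top. (\<integral>\<^sup>+x\<in>{X..2 * X}. G h x \<partial>lborel) / ennreal (X * h) \<le> ennreal r"
      using eventually_ge_at_top[of "h + 1"]
    proof eventually_elim
      case (elim X)
      then have X: "X > 0" "X \<ge> real M" "X \<ge> 1" using h by linarith+
      \<comment> \<open>The least \<open>T\<close> with \<open>X < T * h\<close>; strictness puts
        the end point 2X into one of the half-open steps.\<close>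
      define T where "T = Suc (nat \<lfloor>X / h\<rfloor>)"
      have T: "X / h < real T" "real T \<le> X / h + 1"
        using X(1) \<open>h > 0\<close> unfolding T_def by (simp_all add: of_nat_nat) linarith
      have T': "X < real T * h" "real T * h \<le> X + h"
        using T \<open>h > 0\<close> by (simp_all add: field_simps)
      have "(\<integral>\<^sup>+x\<in>{X..2 * X}. G h x \<partial>lborel) \<le> ennreal (r * X * h)"
      proof (rule nn_integral_split_shift[OF G_meas \<open>h > 0\<close> T'(1)])
        fix u assume u: "0 \<le> u" "u < h"
        have "(\<Sum>t<T. G h (X + real t * h + u)) \<le> ennreal (r / 5 * (X + u + real T * h + 1))"
          using h X u by (intro G_sum) auto
        also have "r / 5 * (X + u + real T * h + 1) \<le> r / 5 * (5 * X)"
          using r u elim T'(2) X by (intro mult_left_mono) auto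
        finally show "(\<Sum>t<T. G h (X + real t * h + u)) \<le> ennreal (r * X)"
          by (simp add: ennreal_leI)
      qed (use r X in simp)
      then have "(\<integral>\<^sup>+x\<in>{X..2 * X}. G h x \<partial>lborel) / ennreal (X * h) \<le> ennreal (r * X * h) / ennreal (X * h)"
        by (rule divide_right_mono_ennreal)
      also have "\<dots> = ennreal r"
        using r X \<open>h > 0\<close> by (simp add: divide_ennreal)
      finally show ?case .
    qed
  qed
  then show "\<forall>\<^sub>F h in at_top. Limsup at_top (\<lambda>X::real.
            (\<integral>\<^sup>+x\<in>{X..2*X}. (SUP f\<in>D.
                ennreal (cmod (\<Sum>n | x \<le> real n \<and> real n < x + h.
                  of_int (moebius_mu n) * \<xi> n * e2pi (f n)))) \<partial>lborel)
            / ennreal (X * h)) \<le> ennreal r"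
    unfolding G_def by (rule eventually_mono[OF eventually_ge_at_top])
qed

end
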